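(* Let $X\subseteq\mathbb{N}$ be an infinite set of even numbers such that for all distinct $n,m\in X$, $(n+m)/2\notin X$ (for example the set of powers of $2$ that are $\ge 2$). Then the class $\{A^*: A \text{ quasimaximal},\ n(A)\in X\}$ is not first-order definable without parameters in $\mathcal{E}^*$.
   Context: $\mathcal{E}$ is the lattice of c.e. subsets of $\mathbb{N}$ under inclusion, $\mathcal{E}^*$ is $\mathcal{E}$ modulo finite differences, $A^*$ the class of $A$. $\mathcal{L}^*(A)$ is the lattice of c.e. supersets of $A$ modulo finite differences. A c.e. set $A$ is quasimaximal if it is an intersection of finitely many maximal sets (equivalently $\mathcal{L}^*(A)$ is finite); for such $A$, $n(A)$ is the number of atoms of $\mathcal{L}^*(A)$. *)

theory Defs
  imports "HOL-Algebra.Order"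
begin

section \<open>Computably enumerable sets\<close>

text \<open>Kleene's partial recursive functions.  Arities are not part of the syntax: a code
  denotes one partial function on argument lists, and unsuitable argument lists lie outside
  its domain.\<close>

datatype recf =
    Zero
  | Succ
  | Proj nat
  | Comp recf "recf list"
  | PrimRec recf recf
  | Mu recf

text \<open>Big-step semantics: \<open>computes f xs y\<close> says that \<open>f\<close> converges on \<open>xs\<close> with value \<open>y\<close>.
  The recursion argument of \<open>PrimRec\<close> and the search argument of \<open>Mu\<close> come first.\<close>

inductive computes :: "recf \<Rightarrow> nat list \<Rightarrow> nat \<Rightarrow> bool" where
  computes_Zero: "computes Zero xs 0"
| computes_Succ: "computes Succ [x] (Suc x)"
| computes_Proj: "i < length xs \<Longrightarrow> computes (Proj i) xs (xs ! i)"
| computes_Comp: "list_all2 (\<lambda>g y. computes g xs y) gs ys \<Longrightarrow> computes f ys z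
    \<Longrightarrow> computes (Comp f gs) xs z"
| computes_PrimRec_0: "computes f xs y \<Longrightarrow> computes (PrimRec f g) (0 # xs) y"
| computes_PrimRec_Suc: "computes (PrimRec f g) (n # xs) r \<Longrightarrow> computes g (n # r # xs) y
    \<Longrightarrow> computes (PrimRec f g) (Suc n # xs) y"
| computes_Mu: "computes f (n # xs) 0 \<Longrightarrow> (\<forall>m<n. \<exists>y. computes f (m # xs) (Suc y))
    \<Longrightarrow> computes (Mu f) xs n"

definition ce :: "nat set \<Rightarrow> bool" where
  "ce A \<longleftrightarrow> (\<exists>f. A = {x. \<exists>y. computes f [x] y})"


section \<open>The lattices of c.e. sets and of c.e. supersets modulo finite differences\<close>

definition eq_fin :: "(nat set \<times> nat set) set" where
  "eq_fin = {(A, B). ce A \<and> ce B \<and> finite (A - B) \<and> finite (B - A)}"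

definition fin_class :: "nat set \<Rightarrow> nat set set" where
  "fin_class A = eq_fin `` {A}"

definition le_fin :: "nat set set \<Rightarrow> nat set set \<Rightarrow> bool" where
  "le_fin U V \<longleftrightarrow> (\<exists>A\<in>U. \<exists>B\<in>V. finite (A - B))"

definition E_star :: "nat set set gorder" where
  "E_star = \<lparr> carrier = {A. ce A} // eq_fin, eq = (=), le = le_fin \<rparr>"

text \<open>A c.e. superset of \<open>A\<close> is represented by its class in \<open>E_star\<close>, so that \<open>L_star A\<close> is
  the part of \<open>E_star\<close> above the class of \<open>A\<close>.\<close>

definition L_star :: "nat set \<Rightarrow> nat set set gorder" where
  "L_star A = \<lparr> carrier = {W. ce W \<and> A \<subseteq> W} // eq_fin, eq = (=), le = le_fin \<rparr>"

lemma equiv_eq_fin: "equiv {A. ce A} eq_fin"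
proof (rule equivI)
  show "eq_fin \<subseteq> {A. ce A} \<times> {A. ce A}"
    by (auto simp: eq_fin_def)
  show "refl_on {A. ce A} eq_fin"
    by (auto simp: refl_on_def eq_fin_def)
  show "sym eq_fin"
    by (auto simp: sym_def eq_fin_def)
  show "trans eq_fin"
  proof (rule transI)
    fix A B C assume "(A, B) \<in> eq_fin" "(B, C) \<in> eq_fin"
    moreover have "A - C \<subseteq> (A - B) \<union> (B - C)" "C - A \<subseteq> (C - B) \<union> (B - A)"
      by auto
    ultimately show "(A, C) \<in> eq_fin"
      by (auto simp: eq_fin_def intro: finite_subset)
  qed
qed

lemma le_fin_fin_class:
  assumes "ce A" "ce B"
  shows "le_fin (fin_class A) (fin_class B) \<longleftrightarrow> finite (A - B)"
proof
  assume "le_fin (fin_class A) (fin_class B)"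
  then obtain A' B' where "finite (A - A')" "finite (A' - B')" "finite (B' - B)"
    by (auto simp: le_fin_def fin_class_def eq_fin_def)
  moreover have "A - B \<subseteq> (A - A') \<union> (A' - B') \<union> (B' - B)"
    by auto
  ultimately show "finite (A - B)"
    by (meson finite_UnI finite_subset)
next
  assume "finite (A - B)"
  moreover have "A \<in> fin_class A" "B \<in> fin_class B"
    using assms by (auto simp: fin_class_def eq_fin_def)
  ultimately show "le_fin (fin_class A) (fin_class B)"
    by (auto simp: le_fin_def)
qed

lemma fin_class_eq_iff:
  assumes "ce A" "ce B"
  shows "fin_class A = fin_class B \<longleftrightarrow> finite (A - B) \<and> finite (B - A)"
  using eq_equiv_class_iff[OF equiv_eq_fin, of A B] assms
  by (auto simp: fin_class_def eq_fin_def)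

lemma carrier_E_star: "carrier E_star = fin_class ` {A. ce A}"
  by (auto simp: E_star_def quotient_def fin_class_def)

lemma carrier_L_star: "carrier (L_star A) = fin_class ` {W. ce W \<and> A \<subseteq> W}"
  by (auto simp: L_star_def quotient_def fin_class_def)

lemma partial_order_E_star: "partial_order E_star"
proof -
  have le: "le E_star = le_fin" and eq: "eq E_star = (=)"
    by (simp_all add: E_star_def)
  have tr: "finite (A - C)" if "finite (A - B)" "finite (B - C)" for A B C :: "nat set"
  proof -
    have "A - C \<subseteq> (A - B) \<union> (B - C)" by auto
    then show ?thesis using that by (meson finite_UnI finite_subset)
  qed
  show ?thesis
  proof (unfold_locales, unfold eq le)
    fix U V assume "U \<in> carrier E_star" "V \<in> carrier E_star" "le_fin U V" "le_fin V U"
    then show "U = V"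
      unfolding carrier_E_star by (metis imageE mem_Collect_eq le_fin_fin_class fin_class_eq_iff)
  next
    fix U V W assume "U \<in> carrier E_star" "V \<in> carrier E_star" "W \<in> carrier E_star"
      and "le_fin U V" "le_fin V W"
    then show "le_fin U W"
      unfolding carrier_E_star by (elim imageE) (simp add: le_fin_fin_class tr)
  qed (auto simp: carrier_E_star le_fin_fin_class)
qed


section \<open>Quasimaximal sets\<close>

definition maximal_ce :: "nat set \<Rightarrow> bool" where
  "maximal_ce M \<longleftrightarrow> ce M \<and> infinite (- M) \<and>
    (\<forall>W. ce W \<and> M \<subseteq> W \<longrightarrow> finite (W - M) \<or> finite (- W))"

text \<open>The empty family is allowed, with intersection \<open>UNIV\<close>.  Its class is that of all cofinite
  sets, the c.e. sets \<open>A\<close> for which \<open>L_star A\<close> has one element and hence no atoms.\<close>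

definition quasimaximal :: "nat set \<Rightarrow> bool" where
  "quasimaximal A \<longleftrightarrow> ce A \<and> (\<exists>\<M>. finite \<M> \<and> (\<forall>M\<in>\<M>. maximal_ce M) \<and> A = \<Inter>\<M>)"

definition atoms :: "'a gorder \<Rightarrow> 'a set" where
  "atoms L = {a \<in> carrier L. a \<noteq> \<bottom>\<^bsub>L\<^esub> \<and>
    (\<forall>x\<in>carrier L. x \<sqsubseteq>\<^bsub>L\<^esub> a \<longrightarrow> x = \<bottom>\<^bsub>L\<^esub> \<or> x = a)}"

definition n_atoms :: "nat set \<Rightarrow> nat" where
  "n_atoms A = card (atoms (L_star A))"


section \<open>First-order definability\<close>

text \<open>First-order formulas with equality over one binary relation symbol, interpreted as the
  order; the lattice operations are first-order definable from the order.\<close>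

datatype fm =
    FEq nat nat
  | FLe nat nat
  | FNeg fm
  | FConj fm fm
  | FEx nat fm

primrec sat :: "'a gorder \<Rightarrow> (nat \<Rightarrow> 'a) \<Rightarrow> fm \<Rightarrow> bool" where
  "sat L s (FEq i j) \<longleftrightarrow> s i = s j"
| "sat L s (FLe i j) \<longleftrightarrow> s i \<sqsubseteq>\<^bsub>L\<^esub> s j"
| "sat L s (FNeg \<phi>) \<longleftrightarrow> \<not> sat L s \<phi>"
| "sat L s (FConj \<phi> \<psi>) \<longleftrightarrow> sat L s \<phi> \<and> sat L s \<psi>"
| "sat L s (FEx i \<phi>) \<longleftrightarrow> (\<exists>a\<in>carrier L. sat L (s(i := a)) \<phi>)"

primrec free_vars :: "fm \<Rightarrow> nat set" where
  "free_vars (FEq i j) = {i, j}"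
| "free_vars (FLe i j) = {i, j}"
| "free_vars (FNeg \<phi>) = free_vars \<phi>"
| "free_vars (FConj \<phi> \<psi>) = free_vars \<phi> \<union> free_vars \<psi>"
| "free_vars (FEx i \<phi>) = free_vars \<phi> - {i}"

text \<open>Only variable \<open>0\<close> may be free, so the values of the assignment at the other variables are
  irrelevant.\<close>

definition FO_definable :: "'a gorder \<Rightarrow> 'a set \<Rightarrow> bool" where
  "FO_definable L C \<longleftrightarrow>
    (\<exists>\<phi>. free_vars \<phi> \<subseteq> {0} \<and> C = {a \<in> carrier L. sat L (\<lambda>_. a) \<phi>})"


section \<open>The powers of two as an example\<close>

lemma powers_of_two_example:
  defines "X \<equiv> {2 ^ k | k. k \<ge> 1} :: nat set"
  shows "infinite X" and "\<forall>n\<in>X. even n"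
    and "\<forall>n\<in>X. \<forall>m\<in>X. n \<noteq> m \<longrightarrow> (n + m) div 2 \<notin> X"
proof -
  have "inj_on (\<lambda>k. 2 ^ k :: nat) {1..}"
    by (auto simp: inj_on_def)
  moreover have "X = (\<lambda>k. 2 ^ k) ` {1..}"
    by (auto simp: X_def)
  ultimately show "infinite X"
    by (simp add: finite_image_iff infinite_Ici)
  show "\<forall>n\<in>X. even n"
    by (auto simp: X_def)
  have *: "(2 ^ i + 2 ^ j) div 2 \<noteq> (2 ^ k :: nat)" if "1 \<le> i" "i < j" for i j k :: nat
  proof
    obtain a where a: "i = Suc a"
      using \<open>1 \<le> i\<close> by (cases i) auto
    obtain d where d: "j = i + Suc d"
      using \<open>i < j\<close> less_imp_Suc_add by fastforce
    assume "(2 ^ i + 2 ^ j) div 2 = (2 ^ k :: nat)"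
    then have "2 ^ a * (1 + 2 ^ Suc d) = (2 ^ k :: nat)"
      by (simp add: a d power_add algebra_simps)
    then have "1 + 2 ^ Suc d dvd (2 ^ k :: nat)"
      by (metis dvd_triv_right)
    moreover have "coprime (1 + 2 ^ Suc d) (2 ^ k :: nat)"
      by simp
    ultimately have "is_unit (1 + 2 ^ Suc d :: nat)"
      by (rule coprime_common_divisor[OF _ dvd_refl, rotated])
    then show False
      by simp
  qed
  show "\<forall>n\<in>X. \<forall>m\<in>X. n \<noteq> m \<longrightarrow> (n + m) div 2 \<notin> X"
  proof (intro ballI impI notI)
    fix n m assume "n \<in> X" "m \<in> X" "n \<noteq> m" "(n + m) div 2 \<in> X"
    then obtain i j k where "n = 2 ^ i" "m = 2 ^ j" "i \<ge> 1" "j \<ge> 1" "(n + m) div 2 = 2 ^ k"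
      by (auto simp: X_def)
    with \<open>n \<noteq> m\<close> show False
      using *[of i j k] *[of j i k] by (cases i j rule: linorder_cases) (auto simp: add.commute)
  qed
qed

end

theory Submission
  imports Defs "HOL-Library.Nat_Bijection" "HOL-Library.Infinite_Set"
begin

text \<open>Splitting a set into its even and its odd part identifies \<open>E_star\<close> with its own square.  By a
  Feferman-Vaught argument a formula sees the first coordinate of the square only through finitely
  many possible sections.  If the formula defined the class, take for every \<open>n \<in> X\<close> a quasimaximal
  set with \<open>n / 2\<close> atoms: two of them, for \<open>n \<noteq> m\<close> in \<open>X\<close>, have the same section.  Since the
  number of atoms is additive, the pair \<open>(n, n)\<close> lies in the class, hence so does \<open>(m, n)\<close>, which
  has \<open>(n + m) / 2\<close> atoms.

  Quasimaximal sets with any number of atoms are sums of copies of a maximal set, which Friedberg's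
  e-state construction provides.  It needs a uniform computable enumeration of all c.e. sets,
  obtained by deriving the judgements ``program \<open>c\<close> on \<open>l\<close> yields \<open>y\<close>'' in stages from Horn
  clauses on codes.\<close>

section \<open>Total computable functions\<close>

text \<open>A function of \<open>k\<close> arguments is a function of an environment, read at \<open>0, \<dots>, k - 1\<close>.  Binding a
  variable is then a shift of indices that beta reduction carries out, so that \<open>computable_intros\<close>
  works by resolution alone.\<close>

definition computable :: "nat \<Rightarrow> ((nat \<Rightarrow> nat) \<Rightarrow> nat) \<Rightarrow> bool" where
  "computable k f \<longleftrightarrow> (\<exists>r. \<forall>e. computes r (map e [0..<k]) (f e))"

definition decidable :: "nat \<Rightarrow> ((nat \<Rightarrow> nat) \<Rightarrow> bool) \<Rightarrow> bool" where
  "decidable k P \<longleftrightarrow> computable k (\<lambda>e. of_bool (P e))"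

named_theorems computable_intros

lemma computable_var [computable_intros]: "i < k \<Longrightarrow> computable k (\<lambda>e. e i)"
  unfolding computable_def
  by (rule exI[of _ "Proj i"]) (metis add_0 computes_Proj diff_zero length_map length_upt nth_map_upt)

lemma computable_compose:
  assumes "computable n g" and "\<And>i. i < n \<Longrightarrow> computable k (h i)"
  shows "computable k (\<lambda>e. g (\<lambda>i. h i e))"
proof -
  obtain r where r: "\<And>e. computes r (map e [0..<n]) (g e)"
    using assms(1) by (auto simp: computable_def)
  obtain q where q: "\<And>i e. i < n \<Longrightarrow> computes (q i) (map e [0..<k]) (h i e)"
    using assms(2) unfolding computable_def by metis
  have "computes (Comp r (map q [0..<n])) (map e [0..<k]) (g (\<lambda>i. h i e))" for e
    by (rule computes_Comp[OF _ r]) (simp add: list_all2_conv_all_nth q)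
  then show ?thesis
    unfolding computable_def by blast
qed

lemma computable_compose1:
  assumes "computable 1 (\<lambda>e. g (e 0))" "computable k a"
  shows "computable k (\<lambda>e. g (a e))"
  using computable_compose[OF assms(1), of k "\<lambda>i. a"] assms(2) by simp

lemma computable_compose2:
  assumes "computable 2 (\<lambda>e. g (e 0) (e 1))" "computable k a" "computable k b"
  shows "computable k (\<lambda>e. g (a e) (b e))"
  using computable_compose[OF assms(1), of k "\<lambda>i. if i = 0 then a else b"] assms by simp

lemma computable_compose3:
  assumes "computable 3 (\<lambda>e. g (e 0) (e 1) (e 2))"
    and "computable k a" "computable k b" "computable k c"
  shows "computable k (\<lambda>e. g (a e) (b e) (c e))"
  using computable_compose[OF assms(1), of k "\<lambda>i. if i = 0 then a else if i = 1 then b else c"]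
    assms by simp

lemma computable_Suc [computable_intros]:
  assumes "computable k f" shows "computable k (\<lambda>e. Suc (f e))"
  by (rule computable_compose1[OF _ assms])
    (auto simp: computable_def intro!: exI[of _ Succ] computes_Succ)

lemma computable_const [computable_intros]: "computable k (\<lambda>e. c)"
proof (induction c)
  case 0
  show ?case by (auto simp: computable_def intro!: exI[of _ Zero] computes_Zero)
qed (rule computable_Suc)

lemma map_upt_Suc_env: "map e [0..<Suc k] = e 0 # map (\<lambda>i. e (Suc i)) [0..<k]"
  by (simp add: upt_conv_Cons flip: map_Suc_upt del: upt_Suc)

text \<open>In the premise on \<open>g\<close> the counter and the previous value are variables 0
  and 1, the order in which \<open>PrimRec\<close> passes them, so the parameters shift by
  two.\<close>

lemma computable_rec_nat [computable_intros]:
  assumes "computable k f"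
    and "computable (Suc (Suc k)) (\<lambda>e. g (e 0) (e 1) (\<lambda>i. e (Suc (Suc i))))"
    and "computable k n"
  shows "computable k (\<lambda>e. rec_nat (f e) (\<lambda>m r. g m r e) (n e))"
proof -
  obtain q where q: "\<And>e. computes q (map e [0..<k]) (f e)"
    using assms(1) by (auto simp: computable_def)
  obtain r where r: "\<And>e. computes r (map e [0..<Suc (Suc k)]) (g (e 0) (e 1) (\<lambda>i. e (Suc (Suc i))))"
    using assms(2) by (auto simp: computable_def)
  have r': "computes r (m # v # map e [0..<k]) (g m v e)" for m v e
    using r[of "case_nat m (case_nat v e)"] by (simp only: map_upt_Suc_env) simp
  have *: "computes (PrimRec q r) (m # map e [0..<k]) (rec_nat (f e) (\<lambda>m r. g m r e) m)" for m e
    by (induction m) (auto intro: computes_PrimRec_0 computes_PrimRec_Suc q r')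
  \<comment> \<open>The bound of the recursion is first kept as variable 0; an arbitrary bound
    \<open>n\<close> is then substituted for it.\<close>
  have "computable (Suc k) (\<lambda>e. rec_nat (f (\<lambda>i. e (Suc i))) (\<lambda>m r. g m r (\<lambda>i. e (Suc i))) (e 0))"
    unfolding computable_def
    by (rule exI[of _ "PrimRec q r"], simp only: map_upt_Suc_env *, simp)
  from computable_compose[OF this, of k "\<lambda>i. if i = 0 then n else (\<lambda>e. e (i - 1))"] assms(3)
  show ?thesis by (simp add: computable_var)
qed

lemma computable_add [computable_intros]:
  assumes "computable k a" "computable k b" shows "computable k (\<lambda>e. a e + b e)"
proof (rule computable_compose2[OF _ assms])
  have "m + n = rec_nat n (\<lambda>_ r. Suc r) m" for m n
    by (induction m) auto
  then show "computable 2 (\<lambda>e. e 0 + e 1)"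
    by (simp only:) (intro computable_intros, simp_all)
qed

lemma computable_mult [computable_intros]:
  assumes "computable k a" "computable k b" shows "computable k (\<lambda>e. a e * b e)"
proof (rule computable_compose2[OF _ assms])
  have "m * n = rec_nat 0 (\<lambda>_ r. n + r) m" for m n
    by (induction m) auto
  then show "computable 2 (\<lambda>e. e 0 * e 1)"
    by (simp only:) (intro computable_intros, simp_all)
qed

lemma computable_power [computable_intros]:
  assumes "computable k a" "computable k b" shows "computable k (\<lambda>e. a e ^ b e)"
proof (rule computable_compose2[OF _ assms])
  have "m ^ n = rec_nat 1 (\<lambda>_ r. m * r) n" for m n :: nat
    by (induction n) auto
  then show "computable 2 (\<lambda>e. e 0 ^ e 1)"
    by (simp only:) (intro computable_intros, simp_all)
qed

lemma computable_diff [computable_intros]: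
  assumes "computable k a" "computable k b" shows "computable k (\<lambda>e. a e - b e)"
proof (rule computable_compose2[OF _ assms])
  \<comment> \<open>The predecessor is a recursion that discards the previous value; subtraction
    iterates it.\<close>
  have pred: "n - 1 = rec_nat 0 (\<lambda>m _. m) n" for n :: nat
    by (cases n) auto
  have "m - n = rec_nat m (\<lambda>_ r. rec_nat 0 (\<lambda>m _. m) r) n" for m n :: nat
    by (induction n) (simp_all flip: pred)
  then show "computable 2 (\<lambda>e. e 0 - e 1)"
    by (simp only:) (intro computable_intros, simp_all)
qed

lemma computable_of_bool [computable_intros]:
  "decidable k P \<Longrightarrow> computable k (\<lambda>e. of_bool (P e))"
  by (simp add: decidable_def)

lemma decidable_not [computable_intros]:
  assumes "decidable k P" shows "decidable k (\<lambda>e. \<not> P e)"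
proof -
  have "computable k (\<lambda>e. 1 - of_bool (P e))"
    by (intro computable_intros assms)
  moreover have "1 - of_bool p = (of_bool (\<not> p) :: nat)" for p
    by simp
  ultimately show ?thesis by (simp only: decidable_def)
qed

lemma decidable_conj [computable_intros]:
  assumes "decidable k P" "decidable k Q" shows "decidable k (\<lambda>e. P e \<and> Q e)"
proof -
  have "computable k (\<lambda>e. of_bool (P e) * of_bool (Q e))"
    by (intro computable_intros assms)
  then show ?thesis by (simp only: decidable_def of_bool_conj)
qed

lemma decidable_disj [computable_intros]:
  assumes "decidable k P" "decidable k Q" shows "decidable k (\<lambda>e. P e \<or> Q e)"
proof -
  have "decidable k (\<lambda>e. \<not> (\<not> P e \<and> \<not> Q e))"
    by (intro computable_intros assms)
  then show ?thesis by simp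
qed

lemma decidable_le [computable_intros]:
  assumes "computable k a" "computable k b" shows "decidable k (\<lambda>e. a e \<le> b e)"
proof -
  have "computable k (\<lambda>e. 1 - (a e - b e))"
    by (intro computable_intros assms)
  moreover have "1 - (m - n) = of_bool (m \<le> n)" for m n :: nat
    by auto
  ultimately show ?thesis by (simp only: decidable_def)
qed

lemma decidable_less [computable_intros]:
  assumes "computable k a" "computable k b" shows "decidable k (\<lambda>e. a e < b e)"
  using decidable_not[OF decidable_le[OF assms(2,1)]] by (simp add: not_le)

lemma decidable_eq [computable_intros]:
  assumes "computable k a" "computable k b" shows "decidable k (\<lambda>e. a e = b e)"
  using decidable_conj[OF decidable_le[OF assms] decidable_le[OF assms(2,1)]]
  by (simp flip: order.eq_iff)

lemma computable_if [computable_intros]: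
  assumes "decidable k P" "computable k a" "computable k b"
  shows "computable k (\<lambda>e. if P e then a e else b e)"
proof -
  have "computable k (\<lambda>e. of_bool (P e) * a e + of_bool (\<not> P e) * b e)"
    by (intro computable_intros assms)
  moreover have "of_bool p * m + of_bool (\<not> p) * n = (if p then m else n)" for p and m n :: nat
    by simp
  ultimately show ?thesis by simp
qed

lemma decidable_subst2:
  assumes "decidable 2 (\<lambda>e. P (e 0) (e 1))" "computable k a" "computable k b"
  shows "decidable k (\<lambda>e. P (a e) (b e))"
  using computable_compose2[of "\<lambda>x y. of_bool (P x y)"] assms by (simp add: decidable_def)

lemma decidable_subst3:
  assumes "decidable 3 (\<lambda>e. P (e 0) (e 1) (e 2))" "computable k a" "computable k b" "computable k c"
  shows "decidable k (\<lambda>e. P (a e) (b e) (c e))"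
  using computable_compose3[of "\<lambda>x y z. of_bool (P x y z)"] assms by (simp add: decidable_def)

lemma computable_sum [computable_intros]:
  assumes "computable (Suc k) (\<lambda>e. f (e 0) (\<lambda>i. e (Suc i)))" "computable k b"
  shows "computable k (\<lambda>e. \<Sum>m<b e. f m e)"
proof -
  \<comment> \<open>The recursion inserts the partial sum as variable 1, so the summand is renamed
    to skip it.\<close>
  have "computable (Suc (Suc k)) (\<lambda>e. f (e 0) (\<lambda>i. e (Suc (Suc i))))"
    using computable_compose[OF assms(1), of "Suc (Suc k)" "\<lambda>i. if i = 0 then \<lambda>e. e 0 else (\<lambda>e. e (Suc i))"]
    by (simp add: computable_var)
  then have "computable k (\<lambda>e. rec_nat 0 (\<lambda>m r. f m e + r) (b e))"
    by (intro computable_intros assms(2)) simp_all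
  moreover have "(\<Sum>m<n. f m e) = rec_nat 0 (\<lambda>m r. f m e + r) n" for n e
    by (induction n) auto
  ultimately show ?thesis by simp
qed

text \<open>An instance exists exactly if the truth values below the bound sum to at least
  one.\<close>

lemma decidable_bex [computable_intros]:
  assumes "decidable (Suc k) (\<lambda>e. P (e 0) (\<lambda>i. e (Suc i)))" "computable k b"
  shows "decidable k (\<lambda>e. \<exists>m<b e. P m e)"
proof -
  have "decidable k (\<lambda>e. (1::nat) \<le> (\<Sum>m<b e. of_bool (P m e)))"
    by (intro computable_intros assms)
  moreover have "(1 \<le> (\<Sum>m<n. of_bool (P m e) :: nat)) \<longleftrightarrow> (\<exists>m<n. P m e)" for n e
    by (induction n) (auto simp: less_Suc_eq)
  ultimately show ?thesis by simp
qed

lemma decidable_ball [computable_intros]: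
  assumes "decidable (Suc k) (\<lambda>e. P (e 0) (\<lambda>i. e (Suc i)))" "computable k b"
  shows "decidable k (\<lambda>e. \<forall>m<b e. P m e)"
proof -
  have "decidable k (\<lambda>e. \<not> (\<exists>m<b e. \<not> P m e))"
    by (intro computable_intros assms)
  then show ?thesis by simp
qed

lemma computable_prod_encode [computable_intros]:
  assumes "computable k a" "computable k b"
  shows "computable k (\<lambda>e. prod_encode (a e, b e))"
proof (rule computable_compose2[of "\<lambda>x y. prod_encode (x, y)", OF _ assms])
  have "triangle n = rec_nat 0 (\<lambda>m r. r + Suc m) n" for n
    by (induction n) auto
  then show "computable 2 (\<lambda>e. prod_encode (e 0, e 1))"
    unfolding prod_encode_def by simp (intro computable_intros, simp_all)
qed

text \<open>Binary digit \<open>n\<close> of \<open>x\<close> is 1 iff \<open>x div 2 ^ n\<close> is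
  odd. Writing the division out with a bounded quotient and a bounded remainder keeps to operations
  already treated.\<close>

lemma decidable_mem_set_decode [computable_intros]:
  assumes "computable k a" "computable k b"
  shows "decidable k (\<lambda>e. a e \<in> set_decode (b e))"
proof -
  have *: "n \<in> set_decode x \<longleftrightarrow> (\<exists>q<Suc x. \<exists>r<2 ^ n. x = (2 * q + 1) * 2 ^ n + r)" for n x
  proof
    assume "n \<in> set_decode x"
    then obtain q where q: "x div 2 ^ n = 2 * q + 1"
      by (auto simp: set_decode_def elim: oddE)
    have "x = (x div 2 ^ n) * 2 ^ n + x mod 2 ^ n" by (rule div_mult_mod_eq[symmetric])
    moreover have "q \<le> x" using q div_le_dividend[of x "2 ^ n"] by linarith
    ultimately show "\<exists>q<Suc x. \<exists>r<2 ^ n. x = (2 * q + 1) * 2 ^ n + r"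
      using q by (intro exI[of _ q] conjI exI[of _ "x mod 2 ^ n"]) auto
  next
    assume "\<exists>q<Suc x. \<exists>r<2 ^ n. x = (2 * q + 1) * 2 ^ n + r"
    then obtain q r where "r < 2 ^ n" "x = (2 * q + 1) * 2 ^ n + r" by auto
    then have "x div 2 ^ n = 2 * q + 1" by (simp only: div_mult_self3) simp
    then show "n \<in> set_decode x" by (simp add: set_decode_def)
  qed
  show ?thesis
    unfolding * by (rule decidable_subst2[OF _ assms]) (intro computable_intros, simp_all)
qed

text \<open>Every stage is a finite set, hence coded by one number, and the passage from stage to
  stage becomes a primitive recursion on codes. The enumeration of the c.e. sets and the
  construction of the maximal set both have this shape.\<close>

lemma decidable_stages:
  assumes S: "S 0 = {}" "\<And>s. S (Suc s) = {t. t < s \<and> F t s (S s)}"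
    and F: "decidable 3 (\<lambda>e. F (e 0) (e 1) (set_decode (e 2)))"
  shows "decidable 2 (\<lambda>e. e 0 \<in> S (e 1))"
proof -
  define c where "c = rec_nat 0 (\<lambda>s r. \<Sum>t<s. if F t s (set_decode r) then 2 ^ t else 0)"
  have c: "c s = set_encode (S s) \<and> finite (S s)" for s
  proof (induction s)
    case (Suc s)
    then have "set_decode (c s) = S s" by simp
    then have "c (Suc s) = (\<Sum>t<s. if F t s (S s) then 2 ^ t else 0)" by (simp add: c_def)
    also have "\<dots> = set_encode (S (Suc s))"
      unfolding set_encode_def S by (simp add: sum.inter_filter lessThan_def flip: sum.inter_filter)
    finally show ?case by (simp add: S)
  qed (simp add: c_def S)
  have "computable 2 (\<lambda>e. c (e 1))"
    unfolding c_def by (intro computable_intros decidable_subst3[OF F]) simp_all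
  then have "decidable 2 (\<lambda>e. e 0 \<in> set_decode (c (e 1)))"
    by (intro computable_intros) simp_all
  then show ?thesis by (simp add: c)
qed


section \<open>A uniform enumeration of the computably enumerable sets\<close>

abbreviation tag :: "nat \<Rightarrow> nat \<Rightarrow> nat" where
  "tag k p \<equiv> prod_encode (k, p)"

text \<open>This is the code that \<open>list_encode\<close> gives to a nonempty list; 0 codes the
  empty list.\<close>

abbreviation cons_code :: "nat \<Rightarrow> nat \<Rightarrow> nat" where
  "cons_code x l \<equiv> Suc (prod_encode (x, l))"

abbreviation judgement :: "nat \<Rightarrow> nat \<Rightarrow> nat \<Rightarrow> nat" where
  "judgement c l y \<equiv> prod_encode (c, prod_encode (l, y))"

primrec code :: "recf \<Rightarrow> nat" where
  "code Zero = tag 0 0"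
| "code Succ = tag 1 0"
| "code (Proj i) = tag 2 i"
| "code (Comp f gs) = tag 3 (prod_encode (code f, list_encode (map code gs)))"
| "code (PrimRec f g) = tag 4 (prod_encode (code f, code g))"
| "code (Mu f) = tag 5 (code f)"

text \<open>Two auxiliary kinds of judgements turn the semantics into Horn clauses: tag 6 evaluates a
  list of programs, and tag 7 states that a program takes nonzero values at all arguments below
  the head of the argument list.\<close>

definition infer :: "nat \<Rightarrow> nat \<Rightarrow> nat set \<Rightarrow> bool" where
  "infer t s D \<longleftrightarrow>
    (\<exists>p<s. \<exists>l<s. t = judgement (tag 0 p) l 0) \<or>
    (\<exists>p<s. \<exists>x<s. t = judgement (tag 1 p) (cons_code x 0) (Suc x)) \<or>
    (\<exists>x<s. \<exists>l<s. t = judgement (tag 2 0) (cons_code x l) x) \<or>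
    (\<exists>i<s. \<exists>x<s. \<exists>l<s. \<exists>y<s. t = judgement (tag 2 (Suc i)) (cons_code x l) y \<and>
      judgement (tag 2 i) l y \<in> D) \<or>
    (\<exists>a<s. \<exists>b<s. \<exists>l<s. \<exists>v<s. \<exists>z<s. t = judgement (tag 3 (prod_encode (a, b))) l z \<and>
      judgement (tag 6 b) l v \<in> D \<and> judgement a v z \<in> D) \<or>
    (\<exists>l<s. t = judgement (tag 6 0) l 0) \<or>
    (\<exists>a<s. \<exists>b<s. \<exists>l<s. \<exists>y<s. \<exists>v<s. t = judgement (tag 6 (cons_code a b)) l (cons_code y v) \<and>
      judgement a l y \<in> D \<and> judgement (tag 6 b) l v \<in> D) \<or>
    (\<exists>a<s. \<exists>b<s. \<exists>l<s. \<exists>y<s. t = judgement (tag 4 (prod_encode (a, b))) (cons_code 0 l) y \<and>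
      judgement a l y \<in> D) \<or>
    (\<exists>a<s. \<exists>b<s. \<exists>n<s. \<exists>l<s. \<exists>r<s. \<exists>y<s.
      t = judgement (tag 4 (prod_encode (a, b))) (cons_code (Suc n) l) y \<and>
      judgement (tag 4 (prod_encode (a, b))) (cons_code n l) r \<in> D \<and>
      judgement b (cons_code n (cons_code r l)) y \<in> D) \<or>
    (\<exists>a<s. \<exists>n<s. \<exists>l<s. t = judgement (tag 5 a) l n \<and>
      judgement a (cons_code n l) 0 \<in> D \<and> judgement (tag 7 a) (cons_code n l) 0 \<in> D) \<or>
    (\<exists>a<s. \<exists>l<s. t = judgement (tag 7 a) (cons_code 0 l) 0) \<or>
    (\<exists>a<s. \<exists>n<s. \<exists>l<s. \<exists>v<s. t = judgement (tag 7 a) (cons_code (Suc n) l) 0 \<and>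
      judgement (tag 7 a) (cons_code n l) 0 \<in> D \<and> judgement a (cons_code n l) (Suc v) \<in> D)"

text \<open>Bounding the conclusion and the witnesses of a rule by \<open>s\<close> keeps each stage
  finite and each step decidable; every rule instance is still reached at some late stage.\<close>

primrec derived :: "nat \<Rightarrow> nat set" where
  "derived 0 = {}"
| "derived (Suc s) = {t. t < s \<and> infer t s (derived s)}"

lemma decidable_derived: "decidable 2 (\<lambda>e. e 0 \<in> derived (e 1))"
proof (rule decidable_stages[of derived infer])
  show "decidable 3 (\<lambda>e. infer (e 0) (e 1) (set_decode (e 2)))"
    unfolding infer_def by (intro computable_intros) simp_all
qed simp_all

lemma infer_mono:
  assumes "infer t s D" "s \<le> s'" "D \<subseteq> D'"
  shows "infer t s' D'"
  using assms(1) unfolding infer_def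
  by (elim disj_forward ex_forward conj_forward) (use assms(2,3) in auto)

lemma derived_Suc_mono: "derived s \<subseteq> derived (Suc s)"
proof (induction s)
  case (Suc s)
  then show ?case
    using infer_mono[of _ s "derived s" "Suc s" "derived (Suc s)"] by auto
qed simp

lemma derived_mono: "s \<le> s' \<Longrightarrow> derived s \<subseteq> derived s'"
  by (rule lift_Suc_mono_le[of derived, OF derived_Suc_mono])

section \<open>Soundness of the derivations\<close>

text \<open>One induction has to carry all three kinds of judgements. Each meaning is conditional on
  the form of \<open>c\<close>, so a judgement whose first component codes nothing is sound
  vacuously.\<close>

definition sound :: "nat \<Rightarrow> nat \<Rightarrow> nat \<Rightarrow> bool" where
  "sound c l y \<longleftrightarrow>
    (\<forall>f. c = code f \<longrightarrow> computes f (list_decode l) y) \<and>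
    (\<forall>gs. c = tag 6 (list_encode (map code gs)) \<longrightarrow>
      list_all2 (\<lambda>g z. computes g (list_decode l) z) gs (list_decode y)) \<and>
    (\<forall>f n l'. c = tag 7 (code f) \<and> l = cons_code n l' \<longrightarrow>
      (\<forall>m<n. \<exists>v. computes f (m # list_decode l') (Suc v)))"

lemma code_eq_tag:
  "code f = tag 0 p \<Longrightarrow> f = Zero"
  "code f = tag 1 p \<Longrightarrow> f = Succ"
  "code f = tag 2 p \<Longrightarrow> f = Proj p"
  "code f = tag 3 p \<Longrightarrow> \<exists>h gs. f = Comp h gs \<and> p = prod_encode (code h, list_encode (map code gs))"
  "code f = tag 4 p \<Longrightarrow> \<exists>h g. f = PrimRec h g \<and> p = prod_encode (code h, code g)"
  "code f = tag 5 p \<Longrightarrow> \<exists>h. f = Mu h \<and> p = code h"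
  "code f \<noteq> tag 6 p"
  "code f \<noteq> tag 7 p"
  by (cases f; simp)+

lemma soundI:
  assumes "\<And>f. code f = c \<Longrightarrow> computes f (list_decode l) y"
    and "\<And>gs. c = tag 6 (list_encode (map code gs)) \<Longrightarrow>
      list_all2 (\<lambda>g z. computes g (list_decode l) z) gs (list_decode y)"
    and "\<And>f n l' m. c = tag 7 (code f) \<Longrightarrow> l = cons_code n l' \<Longrightarrow> m < n \<Longrightarrow>
      \<exists>v. computes f (m # list_decode l') (Suc v)"
  shows "sound c l y"
  using assms unfolding sound_def by blast

lemma soundD: "sound (code f) l y \<Longrightarrow> computes f (list_decode l) y"
  by (simp add: sound_def)

lemma sound_list:
  "sound (tag 6 (list_encode (map code gs))) l y \<Longrightarrow>
    list_all2 (\<lambda>g z. computes g (list_decode l) z) gs (list_decode y)"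
  by (simp add: sound_def)

text \<open>The clauses are checked one by one. Those for projections peel one list entry at a time,
  and tag 7 supplies the nonzero values that \<open>computes_Mu\<close> asks for.\<close>

lemma infer_sound:
  assumes D: "\<And>c l y. judgement c l y \<in> D \<Longrightarrow> sound c l y" and "infer (judgement c l y) s D"
  shows "sound c l y"
  using assms(2) unfolding infer_def
proof (elim disjE exE conjE)
  fix p l'
  assume "judgement c l y = judgement (tag 0 p) l' 0"
  then show ?thesis
    by (intro soundI) (auto dest!: code_eq_tag(1) intro: computes_Zero)
next
  fix p x
  assume "judgement c l y = judgement (tag 1 p) (cons_code x 0) (Suc x)"
  then show ?thesis
    by (intro soundI) (auto dest!: code_eq_tag(2)[unfolded One_nat_def] intro: computes_Succ)
next
  fix x l'
  assume "judgement c l y = judgement (tag 2 0) (cons_code x l') x"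
  then show ?thesis
    by (intro soundI)
      (auto dest!: code_eq_tag(3) intro: computes_Proj[of 0 "x # list_decode l'", simplified])
next
  fix i x l' y'
  assume eq: "judgement c l y = judgement (tag 2 (Suc i)) (cons_code x l') y'"
    and "judgement (tag 2 i) l' y' \<in> D"
  then have "computes (Proj i) (list_decode l') y'"
    using D by (fastforce simp: sound_def)
  then have "computes (Proj (Suc i)) (x # list_decode l') y'"
    by cases (use computes_Proj[of "Suc i" "x # list_decode l'"] in auto)
  then show ?thesis
    using eq by (intro soundI) (auto dest!: code_eq_tag(3))
next
  fix a b l' v z
  assume eq: "judgement c l y = judgement (tag 3 (prod_encode (a, b))) l' z"
    and "judgement (tag 6 b) l' v \<in> D" "judgement a v z \<in> D"
  then have "sound (tag 6 b) l' v" "sound a v z"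
    using D by blast+
  then show ?thesis
    using eq by (intro soundI) (auto dest!: code_eq_tag(4) intro: computes_Comp[OF sound_list soundD])
next
  fix l'
  assume "judgement c l y = judgement (tag 6 0) l' 0"
  then show ?thesis
    by (intro soundI) (auto simp: code_eq_tag(7,8) elim: list_encode.elims)
next
  fix a b l' y' v
  assume eq: "judgement c l y = judgement (tag 6 (cons_code a b)) l' (cons_code y' v)"
    and "judgement a l' y' \<in> D" "judgement (tag 6 b) l' v \<in> D"
  then have *: "sound a l' y'" "sound (tag 6 b) l' v"
    using D by blast+
  have "list_all2 (\<lambda>g z. computes g (list_decode l) z) gs (list_decode y)"
    if "c = tag 6 (list_encode (map code gs))" for gs
    using that eq * by (cases gs) (auto simp: sound_def)
  then show ?thesis
    using eq by (intro soundI) (auto simp: code_eq_tag(7,8) dest: sym)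
next
  fix a b l' y'
  assume eq: "judgement c l y = judgement (tag 4 (prod_encode (a, b))) (cons_code 0 l') y'"
    and "judgement a l' y' \<in> D"
  then have "sound a l' y'" using D by blast
  then show ?thesis
    using eq by (intro soundI) (auto dest!: code_eq_tag(5) simp: sound_def intro: computes_PrimRec_0)
next
  fix a b n l' r y'
  assume eq: "judgement c l y = judgement (tag 4 (prod_encode (a, b))) (cons_code (Suc n) l') y'"
    and "judgement (tag 4 (prod_encode (a, b))) (cons_code n l') r \<in> D"
      "judgement b (cons_code n (cons_code r l')) y' \<in> D"
  then have *: "sound (tag 4 (prod_encode (a, b))) (cons_code n l') r"
    "sound b (cons_code n (cons_code r l')) y'"
    using D by blast+
  have "computes (PrimRec f g) (Suc n # list_decode l') y'" if "a = code f" "b = code g" for f g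
  proof (rule computes_PrimRec_Suc)
    show "computes (PrimRec f g) (n # list_decode l') r"
      using *(1) that by (simp add: sound_def flip: code.simps(5))
    show "computes g (n # r # list_decode l') y'"
      using *(2) that by (simp add: sound_def)
  qed
  then show ?thesis
    using eq by (intro soundI) (auto dest!: code_eq_tag(5))
next
  fix a n l'
  assume eq: "judgement c l y = judgement (tag 5 a) l' n"
    and "judgement a (cons_code n l') 0 \<in> D" "judgement (tag 7 a) (cons_code n l') 0 \<in> D"
  then have "sound a (cons_code n l') 0" "sound (tag 7 a) (cons_code n l') 0"
    using D by blast+
  then show ?thesis
    using eq by (intro soundI) (auto dest!: code_eq_tag(6) simp: sound_def intro!: computes_Mu)
next
  fix a l'
  assume "judgement c l y = judgement (tag 7 a) (cons_code 0 l') 0"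
  then show ?thesis
    by (intro soundI) (auto simp: code_eq_tag(7,8) dest: sym)
next
  fix a n l' v
  assume eq: "judgement c l y = judgement (tag 7 a) (cons_code (Suc n) l') 0"
    and "judgement (tag 7 a) (cons_code n l') 0 \<in> D" "judgement a (cons_code n l') (Suc v) \<in> D"
  then have "sound (tag 7 a) (cons_code n l') 0" "sound a (cons_code n l') (Suc v)"
    using D by blast+
  then show ?thesis
    using eq by (intro soundI) (auto simp: code_eq_tag(7,8) sound_def less_Suc_eq dest: sym)
qed

lemma derived_sound: "judgement c l y \<in> derived s \<Longrightarrow> sound c l y"
proof (induction s arbitrary: c l y)
  case (Suc s)
  then have "infer (judgement c l y) s (derived s)" by simp
  from infer_sound[OF Suc.IH this] show ?case .
qed simp

section \<open>Completeness of the derivations\<close>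

text \<open>\<open>B\<close> collects the witnesses of a rule and \<open>P\<close> its premises.
  Both are finite, so one late stage serves them all and no maximum of stages has to be
  named.\<close>

lemma eventually_derivedI:
  assumes infer: "\<And>s. \<forall>x\<in>B. x < s \<Longrightarrow> P \<subseteq> derived s \<Longrightarrow> infer t s (derived s)"
    and fin: "finite B" "finite P"
    and P: "\<And>u. u \<in> P \<Longrightarrow> \<forall>\<^sub>F s in sequentially. u \<in> derived s"
  shows "\<forall>\<^sub>F s in sequentially. t \<in> derived s"
proof -
  have "\<forall>\<^sub>F s in sequentially. \<forall>x\<in>B. x < s" "\<forall>\<^sub>F s in sequentially. \<forall>u\<in>P. u \<in> derived s"
    using fin P by (auto intro!: eventually_ball_finite eventually_gt_at_top)
  then have "\<forall>\<^sub>F s in sequentially. t \<in> derived (Suc s)"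
    using eventually_gt_at_top[of t] by eventually_elim (auto intro: infer)
  then show ?thesis
    using eventually_sequentially_Suc[of "\<lambda>s. t \<in> derived s"] by blast
qed

lemma derived_complete:
  "computes f xs y \<Longrightarrow> \<forall>\<^sub>F s in sequentially. judgement (code f) (list_encode xs) y \<in> derived s"
proof (induction rule: computes.induct)
  case (computes_Zero xs)
  show ?case
    by (rule eventually_derivedI[of "{0, list_encode xs}"
        "{}"],
        unfold infer_def, simp, blast) (simp_all)
next
  case (computes_Succ x)
  show ?case
    by (rule eventually_derivedI[of "{0, x}"
        "{}"],
        unfold infer_def, simp, blast) (simp_all)
next
  case (computes_Proj i xs)
  then show ?case
  \<comment> \<open>The clauses for projections descend the list, so index and list shrink
    together.\<close>
  proof (induction xs arbitrary: i)
    case (Cons x xs)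
    show ?case
    proof (cases i)
      case 0
      show ?thesis unfolding 0
        by (rule eventually_derivedI[of "{x, list_encode xs}"
        "{}"],
        unfold infer_def, simp, blast) (simp_all)
    next
      case (Suc j)
      have IH: "\<forall>\<^sub>F s in sequentially. judgement (tag 2 j) (list_encode xs) (xs ! j) \<in> derived s"
        using Cons Suc by simp
      show ?thesis unfolding Suc
        by (rule eventually_derivedI[of "{x, list_encode xs, j, xs ! j}"
        "{judgement (tag 2 j) (list_encode xs) (xs ! j)}"],
        unfold infer_def, simp, blast) (use IH in auto)
    qed
  qed simp
next
  case (computes_Comp xs gs ys f z)
  have IH: "\<forall>\<^sub>F s in sequentially.
      judgement (tag 6 (list_encode (map code gs))) (list_encode xs) (list_encode ys) \<in> derived s"
    using computes_Comp(1)
  proof (induction rule: list_all2_induct)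
    case Nil
    show ?case
      by (rule eventually_derivedI[of "{list_encode xs}"
        "{}"],
        unfold infer_def, simp, blast) (simp_all)
  next
    case (Cons g gs y ys)
    show ?case
      by (rule eventually_derivedI[of "{code g, list_encode (map code gs), list_encode xs, y, list_encode ys}"
        "{judgement (code g) (list_encode xs) y,
          judgement (tag 6 (list_encode (map code gs))) (list_encode xs) (list_encode ys)}"],
        unfold infer_def, simp, blast) (use Cons in auto)
  qed
  show ?case
    by (rule eventually_derivedI[of "{code f, list_encode (map code gs), list_encode xs, z, list_encode ys}"
        "{judgement (tag 6 (list_encode (map code gs))) (list_encode xs) (list_encode ys),
        judgement (code f) (list_encode ys) z}"],
        unfold infer_def, simp, blast) (use IH computes_Comp in auto)
next
  case (computes_PrimRec_0 f xs y g)
  show ?case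
    by (rule eventually_derivedI[of "{code f, code g, list_encode xs, y}"
        "{judgement (code f) (list_encode xs) y}"],
        unfold infer_def, simp, blast) (use computes_PrimRec_0 in auto)
next
  case (computes_PrimRec_Suc f g n xs r y)
  show ?case
    by (rule eventually_derivedI[of "{code f, code g, n, r, list_encode xs, y}"
        "{judgement (code (PrimRec f g)) (list_encode (n # xs)) r,
        judgement (code g) (list_encode (n # r # xs)) y}"],
        unfold infer_def, simp, blast) (use computes_PrimRec_Suc.IH in auto)
next
  case (computes_Mu f n xs)
  \<comment> \<open>The tag 7 judgements are derived one after another up to the value
    \<open>n\<close> of the search.\<close>
  have IH: "\<forall>\<^sub>F s in sequentially. judgement (tag 7 (code f)) (list_encode (m # xs)) 0 \<in> derived s"
    if "m \<le> n" for m
    using that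
  proof (induction m)
    case 0
    show ?case
      by (rule eventually_derivedI[of "{code f, list_encode xs}"
        "{}"],
        unfold infer_def, simp, blast) (simp_all)
  next
    case (Suc m)
    then have IH: "\<forall>\<^sub>F s in sequentially. judgement (tag 7 (code f)) (list_encode (m # xs)) 0 \<in> derived s"
      by simp
    obtain v where v:
      "\<forall>\<^sub>F s in sequentially. judgement (code f) (list_encode (m # xs)) (Suc v) \<in> derived s"
      using computes_Mu(3) Suc.prems by (meson Suc_le_lessD)
    show ?case
      by (rule eventually_derivedI[of "{code f, list_encode xs, m, v}"
        "{judgement (tag 7 (code f)) (list_encode (m # xs)) 0,
          judgement (code f) (list_encode (m # xs)) (Suc v)}"],
        unfold infer_def, simp, blast) (use IH v in auto)
  qed
  show ?case
    by (rule eventually_derivedI[of "{code f, list_encode xs, n}"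
        "{judgement (code f) (list_encode (n # xs)) 0,
        judgement (tag 7 (code f)) (list_encode (n # xs)) 0}"],
        unfold infer_def, simp, blast) (use computes_Mu(2) IH[OF order_refl] in auto)
qed

section \<open>Stagewise enumeration and the normal form of c.e. sets\<close>

text \<open>\<open>cons_code x 0\<close> codes the argument list \<open>[x]\<close>. Bounding the
  value \<open>y\<close> by \<open>s\<close> makes membership decidable.\<close>

definition W_stage :: "nat \<Rightarrow> nat \<Rightarrow> nat set" where
  "W_stage c s = {x. \<exists>y<s. judgement c (cons_code x 0) y \<in> derived s}"

lemma W_stage_mono: "s \<le> s' \<Longrightarrow> W_stage c s \<subseteq> W_stage c s'"
  unfolding W_stage_def using derived_mono[of s s'] by (auto intro: less_le_trans)

lemma decidable_W_stage [computable_intros]: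
  assumes "computable k a" "computable k c" "computable k s"
  shows "decidable k (\<lambda>e. a e \<in> W_stage (c e) (s e))"
proof (rule decidable_subst3[of "\<lambda>x c s. x \<in> W_stage c s", OF _ assms])
  show "decidable 3 (\<lambda>e. e 0 \<in> W_stage (e 1) (e 2))"
    unfolding W_stage_def mem_Collect_eq
    by (intro computable_intros decidable_subst2[OF decidable_derived]) simp_all
qed

text \<open>The code of a program serves as index: completeness of the derivations gives one
  inclusion, soundness the other.\<close>

lemma ce_W_stage: "ce A \<Longrightarrow> \<exists>c. A = (\<Union>s. W_stage c s)"
proof -
  assume "ce A"
  then obtain f where f: "A = {x. \<exists>y. computes f [x] y}" by (auto simp: ce_def)
  have "x \<in> (\<Union>s. W_stage (code f) s)" if "computes f [x] y" for x y
  proof -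
    have "\<forall>\<^sub>F s in sequentially. x \<in> W_stage (code f) s"
      using derived_complete[OF that] eventually_gt_at_top[of y]
      by eventually_elim (auto simp: W_stage_def)
    then show ?thesis
      by (auto simp: eventually_sequentially)
  qed
  moreover have "\<exists>y. computes f [x] y" if "x \<in> W_stage (code f) s" for x s
    proof -
    obtain y where "judgement (code f) (cons_code x 0) y \<in> derived s"
      using \<open>x \<in> W_stage (code f) s\<close> by (auto simp: W_stage_def)
    from derived_sound[OF this] show ?thesis by (auto simp: sound_def)
  qed
  ultimately have "A = (\<Union>s. W_stage (code f) s)" unfolding f by blast
  then show ?thesis ..
qed

text \<open>This allows one to conclude from a successful search that the decided relation holds at
  the number found.\<close>

lemma computes_unique: "computes f xs y \<Longrightarrow> computes f xs z \<Longrightarrow> z = y"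
proof (induction arbitrary: z rule: computes.induct)
  case (computes_Comp xs gs ys f z')
  from computes_Comp(4) obtain ys' where ys': "list_all2 (\<lambda>g y. computes g xs y) gs ys'" "computes f ys' z"
    by cases auto
  from computes_Comp(1) ys'(1) have "ys' = ys"
    by (auto simp: list_all2_conv_all_nth intro: nth_equalityI)
  then show ?case using computes_Comp.IH ys'(2) by blast
next
  case (computes_PrimRec_0 f xs y g)
  from computes_PrimRec_0(3) show ?case
    by cases (use computes_PrimRec_0(2) in blast)
next
  case (computes_PrimRec_Suc f g n xs r y)
  from computes_PrimRec_Suc(5) show ?case
    by cases (use computes_PrimRec_Suc.IH in blast)
next
  case (computes_Mu f n xs)
  from computes_Mu(4) have z: "computes f (z # xs) 0" "\<forall>m<z. \<exists>y. computes f (m # xs) (Suc y)"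
    by (cases, auto)+
  show ?case
  proof (rule linorder_cases[of z n])
    assume "z < n"
    then show ?thesis using computes_Mu(3) z(1) by (metis nat.distinct(1))
  next
    assume "n < z"
    then show ?thesis using computes_Mu(2) z(2) by (metis nat.distinct(1))
  qed
qed (auto elim: computes.cases)

text \<open>The set is the domain of an unbounded search. As \<open>Mu\<close> looks for a zero, the
  search runs through the characteristic function of the negation.\<close>

lemma ce_decidable:
  assumes "decidable 2 (\<lambda>e. P (e 0) (e 1))"
  shows "ce {x. \<exists>s. P s x}"
proof -
  have "computable 2 (\<lambda>e. of_bool (\<not> P (e 0) (e 1)))"
    using assms by (intro computable_intros)
  then obtain r where r: "\<And>e. computes r (map e [0..<2]) (of_bool (\<not> P (e 0) (e 1)))"
    by (auto simp: computable_def)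
  have r': "computes r [s, x] (of_bool (\<not> P s x))" for s x
    using r[of "case_nat s (\<lambda>_. x)"] by (simp add: numeral_2_eq_2)
  have "(\<exists>s. P s x) \<longleftrightarrow> (\<exists>y. computes (Mu r) [x] y)" for x
  proof
    assume ex: "\<exists>s. P s x"
    have "computes (Mu r) [x] (LEAST s. P s x)"
    proof (rule computes_Mu)
      show "computes r [LEAST s. P s x, x] 0"
        using r'[of "LEAST s. P s x" x] LeastI_ex[OF ex] by simp
      show "\<forall>m<LEAST s. P s x. \<exists>y. computes r [m, x] (Suc y)"
      proof (intro allI impI)
        fix m assume "m < (LEAST s. P s x)"
        then have "\<not> P m x" by (rule not_less_Least)
        then show "\<exists>y. computes r [m, x] (Suc y)" using r'[of m x] by auto
      qed
    qed
    then show "\<exists>y. computes (Mu r) [x] y" ..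
  next
    assume "\<exists>y. computes (Mu r) [x] y"
    then obtain y where "computes r [y, x] 0" by (auto elim: computes.cases)
    then have "of_bool (\<not> P y x) = (0::nat)" using computes_unique r' by metis
    then show "\<exists>s. P s x" by auto
  qed
  then show ?thesis unfolding ce_def by blast
qed

text \<open>In this normal form, closure properties of c.e. sets follow from those of decidable
  relations without writing programs.\<close>

lemma ce_iff_decidable:
  "ce A \<longleftrightarrow> (\<exists>P. decidable 2 (\<lambda>e. P (e 0) (e 1)) \<and> A = {x. \<exists>s. P s x})"
proof
  assume "ce A"
  then obtain c where "A = (\<Union>s. W_stage c s)" using ce_W_stage by blast
  moreover have "decidable 2 (\<lambda>e. e 1 \<in> W_stage c (e 0))"
    by (intro computable_intros) simp_all
  ultimately show "\<exists>P. decidable 2 (\<lambda>e. P (e 0) (e 1)) \<and> A = {x. \<exists>s. P s x}"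
    by (intro exI[of _ "\<lambda>s x. x \<in> W_stage c s"]) auto
qed (auto intro: ce_decidable)


section \<open>A maximal set\<close>

definition W_limit :: "nat \<Rightarrow> nat set" where
  "W_limit c = (\<Union>s. W_stage c s)"

text \<open>The first \<open>e\<close> sets enter the state of length \<open>e\<close>, the most significant bit belonging to the
  first one.  The \<open>e\<close>-th element of the complement is judged by its state of length \<open>e\<close>.\<close>

primrec e_state :: "nat \<Rightarrow> nat \<Rightarrow> nat \<Rightarrow> nat" where
  "e_state s x 0 = 0"
| "e_state s x (Suc e) = 2 * e_state s x e + of_bool (x \<in> W_stage e s)"

primrec final_e_state :: "nat \<Rightarrow> nat \<Rightarrow> nat" where
  "final_e_state x 0 = 0"
| "final_e_state x (Suc e) = 2 * final_e_state x e + of_bool (x \<in> W_limit e)"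

text \<open>For \<open>y\<close> outside \<open>M\<close> this is the position of \<open>y\<close>
  in the complement, counted from 0. The sum is a form that \<open>computable_intros\<close>
  handles.\<close>

definition rank_outside :: "nat set \<Rightarrow> nat \<Rightarrow> nat" where
  "rank_outside M y = (\<Sum>w<y. of_bool (w \<notin> M))"

text \<open>Here \<open>z\<close> is a later element of the complement that would improve the
  e-state at the position \<open>e\<close> now held by \<open>y\<close>.\<close>

definition prefers :: "nat \<Rightarrow> nat set \<Rightarrow> nat \<Rightarrow> nat \<Rightarrow> bool" where
  "prefers s M y z \<longleftrightarrow> y < z \<and> z \<notin> M \<and>
    e_state s y (rank_outside M y) < e_state s z (rank_outside M y)"

definition attention :: "nat \<Rightarrow> nat set \<Rightarrow> nat \<Rightarrow> bool" where
  "attention s M y \<longleftrightarrow> y \<notin> M \<and> (\<exists>z<s. prefers s M y z)"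

text \<open>The least \<open>y\<close> requiring attention is replaced by the least \<open>z\<close>
  that it prefers: the whole interval from \<open>y\<close> up to but excluding \<open>z\<close>
  enters, which moves \<open>z\<close> into the position of \<open>y\<close>. The description is by
  single elements \<open>x\<close> to fit \<open>decidable_stages\<close>.\<close>

definition enters :: "nat \<Rightarrow> nat \<Rightarrow> nat set \<Rightarrow> bool" where
  "enters x s M \<longleftrightarrow> x \<in> M \<or> (\<exists>y<Suc x. attention s M y \<and> (\<forall>w<y. \<not> attention s M w) \<and>
    (\<forall>z<Suc x. \<not> prefers s M y z))"

primrec max_stage :: "nat \<Rightarrow> nat set" where
  "max_stage 0 = {}"
| "max_stage (Suc s) = {x. x < s \<and> enters x s (max_stage s)}"

definition max_set :: "nat set" where
  "max_set = (\<Union>s. max_stage s)"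

lemma rank_outside_card: "rank_outside M y = card ({..<y} - M)"
  by (simp add: rank_outside_def sum.If_cases of_bool_def Diff_eq Compl_eq)

lemma rank_outside_le: "rank_outside M y \<le> y"
  unfolding rank_outside_card using card_mono[of "{..<y}" "{..<y} - M"] by auto

lemma decidable_max_stage: "decidable 2 (\<lambda>e. e 0 \<in> max_stage (e 1))"
proof (rule decidable_stages[of max_stage enters])
  have state: "e_state s x k = rec_nat 0 (\<lambda>i r. 2 * r + of_bool (x \<in> W_stage i s)) k" for s x k
    by (induction k) auto
  show "decidable 3 (\<lambda>e. enters (e 0) (e 1) (set_decode (e 2)))"
    unfolding enters_def attention_def prefers_def state rank_outside_def
    by (intro computable_intros) simp_all
qed simp_all

lemma ce_max_set: "ce max_set"
proof -
  have "decidable 2 (\<lambda>e. e 1 \<in> max_stage (e 0))"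
    by (rule decidable_subst2[OF decidable_max_stage]) (simp_all add: computable_var)
  from ce_decidable[OF this] show ?thesis by (simp add: max_set_def UNION_eq)
qed

lemma max_stage_less: "x \<in> max_stage s \<Longrightarrow> x < s"
  by (cases s) auto

lemma finite_max_stage: "finite (max_stage s)"
  by (rule finite_subset[of _ "{..<s}"]) (auto simp: max_stage_less)

lemma max_stage_Suc: "max_stage s \<subseteq> max_stage (Suc s)"
  by (auto simp: enters_def dest: max_stage_less)

lemma max_stage_mono: "s \<le> s' \<Longrightarrow> max_stage s \<subseteq> max_stage s'"
  by (rule lift_Suc_mono_le[of max_stage, OF max_stage_Suc])

text \<open>A newly entering number lies below every candidate that the moving element prefers, and
  one of these candidates is below \<open>s\<close>.\<close>

lemma max_stage_Suc_iff:
  "x \<in> max_stage (Suc s) \<longleftrightarrow> enters x s (max_stage s)"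
proof -
  have "x < s" if "enters x s (max_stage s)"
    using that unfolding enters_def
  proof (elim disjE exE conjE)
    fix y assume y: "attention s (max_stage s) y" "\<forall>z<Suc x. \<not> prefers s (max_stage s) y z"
    then obtain z where "z < s" "prefers s (max_stage s) y z" by (auto simp: attention_def)
    with y(2) show "x < s" by (meson less_Suc_eq_le not_le less_trans)
  qed (rule max_stage_less)
  then show ?thesis by auto
qed

lemma eventually_mem_Union:
  assumes "\<And>s s'. s \<le> s' \<Longrightarrow> S s \<subseteq> S s'"
  shows "\<forall>\<^sub>F s in sequentially. x \<in> S s \<longleftrightarrow> x \<in> (\<Union>s. S s)"
proof (cases "x \<in> (\<Union>s. S s)")
  case True
  then obtain s0 where "x \<in> S s0" by blast
  then show ?thesis
    using assms by (intro eventually_sequentiallyI[of s0]) blast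
qed (intro always_eventually, blast)

lemma eventually_max_stage: "\<forall>\<^sub>F s in sequentially. \<forall>x<b. x \<in> max_stage s \<longleftrightarrow> x \<in> max_set"
proof -
  have "\<forall>\<^sub>F s in sequentially. \<forall>x\<in>{..<b}. x \<in> max_stage s \<longleftrightarrow> x \<in> max_set"
    unfolding max_set_def
    by (intro eventually_ball_finite ballI eventually_mem_Union max_stage_mono) auto
  then show ?thesis by (simp add: Ball_def)
qed

lemma eventually_e_state: "\<forall>\<^sub>F s in sequentially. e_state s x k = final_e_state x k"
proof (induction k)
  case (Suc k)
  have "\<forall>\<^sub>F s in sequentially. x \<in> W_stage k s \<longleftrightarrow> x \<in> W_limit k"
    unfolding W_limit_def by (intro eventually_mem_Union W_stage_mono)
  with Suc show ?case by eventually_elim simp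
qed simp

lemma e_state_less: "e_state s x k < 2 ^ k"
  by (induction k) auto

lemma e_state_mono: "s \<le> s' \<Longrightarrow> e_state s x k \<le> e_state s' x k"
proof (induction k)
  case (Suc k)
  then show ?case using W_stage_mono[of s s' k] by (auto simp: of_bool_def)
qed simp

lemma least_attention_enters:
  assumes "attention s M y" "\<And>w. w < y \<Longrightarrow> \<not> attention s M w"
  shows "enters y s M"
  using assms by (auto simp: enters_def prefers_def intro!: exI[of _ y])

text \<open>If the complement were finite, then past some stage the least element of the approximated
  complement outside it would move infinitely often, raising its e-state for a fixed e each time.\<close>

lemma infinite_max_set_complement: "infinite (- max_set)"
proof
  assume fin: "finite (- max_set)"
  \<comment> \<open>\<open>N\<close> is the supposed finite complement. Once the part below
    \<open>b\<close> has settled, position \<open>e\<close> is the first one held by a number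
    outside \<open>N\<close>; its holder is \<open>m s\<close>.\<close>
  define N where "N = - max_set"
  define e where "e = card N"
  obtain b where b: "\<And>x. x \<in> N \<Longrightarrow> x < b"
    using fin by (auto simp: N_def finite_nat_set_iff_bounded)
  obtain s0 where s0: "\<And>s x. s \<ge> s0 \<Longrightarrow> x < b \<Longrightarrow> x \<in> max_stage s \<longleftrightarrow> x \<in> max_set"
    using eventually_max_stage[of b] by (auto simp: eventually_sequentially)
  define m where "m s = (LEAST x. x \<notin> max_stage s \<and> x \<notin> N)" for s
  have "\<exists>x. x \<notin> max_stage s \<and> x \<notin> N" for s
  proof -
    have "finite (max_stage s \<union> N)" using fin finite_max_stage by (simp add: N_def)
    then show ?thesis using ex_new_if_finite[OF infinite_UNIV_nat] by blast
  qed
  then have m: "m s \<notin> max_stage s" "m s \<notin> N" for s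
    unfolding m_def using LeastI_ex[of "\<lambda>x. x \<notin> max_stage s \<and> x \<notin> N"] by auto
  have m_le: "m s \<le> x" if "x \<notin> max_stage s" "x \<notin> N" for s x
    unfolding m_def using that by (simp add: Least_le)
  have m_eqI: "m s = x" if "x \<notin> max_stage s" "x \<notin> N" "\<And>w. w < x \<Longrightarrow> w \<in> max_stage s \<or> w \<in> N" for s x
    using that m m_le by (metis linorder_neqE_nat not_le)
  have N_stage: "x \<notin> max_stage s" if "x \<in> N" for x s
    using that by (auto simp: N_def max_set_def)
  have b_le: "b \<le> m s" if "s \<ge> s0" for s
    using s0[OF that, of "m s"] m[of s] by (force simp: N_def)
  have rank: "rank_outside (max_stage s) (m s) = e" if "s \<ge> s0" for s
  proof -
    have "{..<m s} - max_stage s = N"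
      using b b_le[OF that] N_stage m_le[of _ s] by (auto intro: less_le_trans) (meson not_le)
    then show ?thesis by (simp add: rank_outside_card e_def)
  qed
  define f where "f s = e_state s (m s) e" for s
  \<comment> \<open>Either the holder of position \<open>e\<close> stays, and its state can only
    grow, or its successor has a strictly larger state.\<close>
  have step: "m (Suc s) = m s \<and> f s \<le> f (Suc s) \<or> f s < f (Suc s)" if "s \<ge> s0" for s
  proof (cases "m s \<in> max_stage (Suc s)")
    case False
    have "m (Suc s) = m s"
      using False m max_stage_Suc m_le by (intro m_eqI) (auto simp del: max_stage.simps, meson not_le subsetD)
    then show ?thesis by (simp add: f_def e_state_mono)
  next
    case True
    define M where "M = max_stage s"
    from True m(1)[of s] obtain y where y: "y \<le> m s" "attention s M y" "\<And>w. w < y \<Longrightarrow> \<not> attention s M w"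
      unfolding max_stage_Suc_iff enters_def M_def by (auto simp: less_Suc_eq_le)
    have y_new: "y \<in> max_stage (Suc s)"
      using least_attention_enters[OF y(2,3)] by (simp only: max_stage_Suc_iff M_def)
    have "y \<notin> M" using y(2) by (simp add: attention_def)
    moreover have "y \<notin> N" using y_new N_stage by blast
    \<comment> \<open>The moving element \<open>y\<close> is itself new in the set, so it cannot lie
      below \<open>m s\<close>: it is \<open>m s\<close> that moves.\<close>
    ultimately have "m s \<le> y" by (intro m_le) (simp_all add: M_def)
    then have y_eq: "y = m s" using y(1) by simp
    obtain z0 where "prefers s M y z0" using y(2) by (auto simp: attention_def)
    define z where "z = (LEAST z. prefers s M y z)"
    have z: "prefers s M y z"
      unfolding z_def by (rule LeastI) fact
    have z_min: "\<not> prefers s M y w" if "w < z" for w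
      using that unfolding z_def by (rule not_less_Least)
    have between: "x \<in> max_stage (Suc s)" if "y \<le> x" "x < z" for x
      unfolding max_stage_Suc_iff enters_def using y that z_min
      by (auto simp: M_def intro!: exI[of _ y])
    have "z \<notin> max_stage (Suc s)"
    proof
      assume "z \<in> max_stage (Suc s)"
      moreover have "z \<notin> M" using z by (simp add: prefers_def)
      ultimately obtain y' where y': "attention s M y'" "\<And>w. w < y' \<Longrightarrow> \<not> attention s M w"
        "\<not> prefers s M y' z"
        unfolding max_stage_Suc_iff enters_def M_def by auto
      then have "y' = y" using y(2,3) by (metis linorder_neqE_nat)
      then show False using y'(3) z by simp
    qed
    moreover have "y < z" using z by (simp add: prefers_def)
    moreover have "z \<notin> N" using b[of z] b_le[OF that] \<open>y < z\<close> y_eq by auto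
    moreover have "w \<in> max_stage (Suc s) \<or> w \<in> N" if "w < z" for w
    proof (cases "w < y")
      case True
      then have "w \<in> max_stage s \<or> w \<in> N" using m_le[of w s] y_eq by force
      then show ?thesis using max_stage_Suc by blast
    qed (use between that in auto)
    ultimately have "m (Suc s) = z" by (intro m_eqI)
    moreover have "e_state s (m s) e < e_state s z e"
      using z rank[OF that] y_eq by (simp add: prefers_def M_def)
    moreover have "e_state s z e \<le> e_state (Suc s) z e" by (simp add: e_state_mono)
    ultimately show ?thesis by (simp add: f_def)
  qed
  \<comment> \<open>States of length \<open>e\<close> are below \<open>2 ^ e\<close>, so
    \<open>f\<close> attains a maximum. From then on the holder is constant, hence never enters,
    although it is outside \<open>N\<close>.\<close>
  have "\<exists>s1\<ge>s0. \<forall>s\<ge>s0. f s \<le> f s1"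
    using ex_has_greatest_nat[of "\<lambda>s. s \<ge> s0" s0 f "2 ^ e"] e_state_less[of _ _ e]
    by (auto simp: f_def)
  then obtain s1 where s1: "s1 \<ge> s0" "\<And>s. s \<ge> s0 \<Longrightarrow> f s \<le> f s1" by blast
  have const: "m (s1 + d) = m s1 \<and> f (s1 + d) = f s1" for d
  proof (induction d)
    case (Suc d)
    then show ?case using step[of "s1 + d"] s1(1) s1(2)[of "Suc (s1 + d)"] by auto
  qed simp
  have "m s1 \<notin> max_stage s" for s
  proof -
    have "m s1 \<notin> max_stage (s1 + s)" using m(1)[of "s1 + s"] const by simp
    then show ?thesis using max_stage_mono[of s "s1 + s"] by auto
  qed
  then have "m s1 \<in> N" by (simp add: N_def max_set_def)
  then show False using m(2) by blast
qed

section \<open>Cohesiveness of the complement\<close>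

text \<open>States are binary numbers with the earliest set in the leading digit, so the first
  difference decides, whatever the later sets contribute.\<close>

lemma final_e_state_less:
  assumes "\<forall>i<e. y \<in> W_limit i \<longleftrightarrow> z \<in> W_limit i" "y \<notin> W_limit e" "z \<in> W_limit e" "e < k"
  shows "final_e_state y k < final_e_state z k"
  using assms(4)
proof (induction k)
  case (Suc k)
  show ?case
  proof (cases "k = e")
    case True
    have "final_e_state y i = final_e_state z i" if "i \<le> e" for i
      using that by (induction i) (use assms(1) in auto)
    then show ?thesis using assms(2,3) True by simp
  next
    case False
    then have "final_e_state y k < final_e_state z k" using Suc by simp
    then show ?thesis by (simp add: of_bool_def)
  qed
qed simp

text \<open>When membership up to \<open>y\<close> has settled and \<open>y\<close> requires
  attention, the least number requiring attention is at most \<open>y\<close> and enters at once,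
  which changes the settled part.\<close>

lemma not_eventually_attention:
  assumes "y \<notin> max_set"
  shows "\<not> (\<forall>\<^sub>F s in sequentially. attention s (max_stage s) y)"
proof
  assume "\<forall>\<^sub>F s in sequentially. attention s (max_stage s) y"
  moreover have "\<forall>\<^sub>F s in sequentially. \<forall>x<Suc y. x \<in> max_stage (Suc s) \<longleftrightarrow> x \<in> max_set"
    using eventually_max_stage eventually_sequentially_Suc[of "\<lambda>s. \<forall>x<Suc y. x \<in> max_stage s \<longleftrightarrow> x \<in> max_set"]
    by blast
  ultimately have "\<forall>\<^sub>F s in sequentially. False"
    using eventually_max_stage[of "Suc y"]
  proof eventually_elim
    case (elim s)
    define w where "w = (LEAST w. attention s (max_stage s) w)"
    have w: "attention s (max_stage s) w"
      unfolding w_def by (rule LeastI) fact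
    have "enters w s (max_stage s)"
      by (rule least_attention_enters[OF w]) (auto simp: w_def dest: not_less_Least)
    then have "w \<in> max_stage (Suc s)" by (simp only: max_stage_Suc_iff)
    moreover have "w \<notin> max_stage s" using w by (simp add: attention_def)
    moreover have "w < Suc y" unfolding w_def using elim(1) by (simp add: Least_le less_Suc_eq_le)
    ultimately show False using elim by blast
  qed
  then show False by simp
qed

text \<open>Up to finitely many exceptions the complement agrees on all earlier sets. If set number
  \<open>e\<close> split it into two infinite parts, some \<open>y\<close> outside that set would
  forever prefer a later \<open>z\<close> inside it, and so require attention at all late
  stages.\<close>

lemma max_set_cohesive: "finite (W_limit e - max_set) \<or> finite (- max_set - W_limit e)"
proof (induction e rule: less_induct)
  case (less e)
  \<comment> \<open>\<open>F i\<close> is the finite one of the two parts into which set number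
    \<open>i\<close> divides the complement.\<close>
  define F where "F i = (if finite (W_limit i - max_set) then W_limit i - max_set else - max_set - W_limit i)" for i
  have "finite (F i)" if "i < e" for i using less[OF that] by (auto simp: F_def)
  then have "finite (\<Union>i<e. F i)" by blast
  show ?case
  proof (rule ccontr)
    assume "\<not> ?thesis"
    then have inf: "infinite (W_limit e - max_set - (\<Union>i<e. F i))"
      "infinite (- max_set - W_limit e - (\<Union>i<e. F i))"
      using \<open>finite (\<Union>i<e. F i)\<close> by (simp_all add: Diff_infinite_finite)
    \<comment> \<open>Choosing \<open>y\<close> beyond \<open>e + 1\<close> elements of the
      complement puts it at a position above \<open>e\<close>, so that its state takes set number
      \<open>e\<close> into account.\<close>
    obtain S where S: "S \<subseteq> - max_set" "finite S" "card S = Suc e"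
      using infinite_arbitrarily_large[OF infinite_max_set_complement] by blast
    obtain b where b: "S \<subseteq> {..<b}" using S(2) by (auto simp: finite_nat_set_iff_bounded)
    obtain y where y: "y > b" "y \<notin> max_set" "y \<notin> W_limit e" "y \<notin> (\<Union>i<e. F i)"
      using inf(2) unfolding infinite_nat_iff_unbounded by blast
    obtain z where z: "z > y" "z \<notin> max_set" "z \<in> W_limit e" "z \<notin> (\<Union>i<e. F i)"
      using inf(1) unfolding infinite_nat_iff_unbounded by blast
    have same: "\<forall>i<e. y \<in> W_limit i \<longleftrightarrow> z \<in> W_limit i"
      using y z by (auto simp: F_def split: if_splits)
    have rank: "e < rank_outside (max_stage s) y" for s
    proof -
      have "S \<subseteq> {..<y} - max_stage s" using S(1) b y(1) by (force simp: max_set_def)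
      from card_mono[OF _ this] S(3) show ?thesis by (simp add: rank_outside_card)
    qed
    \<comment> \<open>The position of \<open>y\<close> may change with \<open>s\<close> but never
      exceeds \<open>y\<close>, so the states of all lengths up to \<open>y\<close> are made to
      settle together.\<close>
    have "\<forall>\<^sub>F s in sequentially. \<forall>k\<in>{..y}. e_state s x k = final_e_state x k" for x
      by (intro eventually_ball_finite ballI eventually_e_state) simp
    from this[of y] this[of z] eventually_gt_at_top[of z]
    have "\<forall>\<^sub>F s in sequentially. attention s (max_stage s) y"
    proof eventually_elim
      case (elim s)
      have "prefers s (max_stage s) y z"
        using elim rank_outside_le[of "max_stage s" y] z(1,2) final_e_state_less[OF same y(3) z(3) rank]
        by (simp add: prefers_def max_set_def)
      then show ?case using elim(3) y(2) by (auto simp: attention_def max_set_def)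
    qed
    then show False using not_eventually_attention[OF y(2)] by blast
  qed
qed

lemma maximal_ce_max_set: "maximal_ce max_set"
  unfolding maximal_ce_def
proof (intro conjI allI impI ce_max_set infinite_max_set_complement)
  fix W assume W: "ce W \<and> max_set \<subseteq> W"
  then obtain c where c: "W = W_limit c" unfolding W_limit_def using ce_W_stage by blast
  have "- max_set - W = - W" using W by blast
  with max_set_cohesive[of c] show "finite (W - max_set) \<or> finite (- W)" by (simp add: c)
qed


section \<open>The even-odd splitting\<close>

definition join :: "nat set \<Rightarrow> nat set \<Rightarrow> nat set" where
  "join A B = (\<lambda>x. 2 * x) ` A \<union> (\<lambda>x. Suc (2 * x)) ` B"

lemma mem_join [simp]: "2 * x \<in> join A B \<longleftrightarrow> x \<in> A" "Suc (2 * x) \<in> join A B \<longleftrightarrow> x \<in> B"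
  by (auto simp: join_def image_iff double_not_eq_Suc_double Suc_double_not_eq_double)

lemma all_double: "(\<forall>x::nat. P x) \<longleftrightarrow> (\<forall>y. P (2 * y)) \<and> (\<forall>y. P (Suc (2 * y)))"
  by (metis evenE oddE Suc_eq_plus1)

text \<open>Set identities are thereby checked separately on the even and on the odd
  numbers.\<close>

lemma join_eq_iff: "join A B = W \<longleftrightarrow> A = {x. 2 * x \<in> W} \<and> B = {x. Suc (2 * x) \<in> W}"
  unfolding set_eq_iff by (subst all_double) simp

lemma join_subset_iff: "join A B \<subseteq> W \<longleftrightarrow> A \<subseteq> {x. 2 * x \<in> W} \<and> B \<subseteq> {x. Suc (2 * x) \<in> W}"
  by (auto simp: join_def)

lemma join_split: "W = join {x. 2 * x \<in> W} {x. Suc (2 * x) \<in> W}"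
  by (rule sym) (simp add: join_eq_iff)

lemma join_Diff: "join A B - join C D = join (A - C) (B - D)"
  by (rule sym) (auto simp: join_eq_iff)

lemma Compl_join: "- join A B = join (- A) (- B)"
  by (rule sym) (auto simp: join_eq_iff)

lemma finite_join_iff: "finite (join A B) \<longleftrightarrow> finite A \<and> finite B"
  by (simp add: join_def finite_image_iff inj_on_def)

section \<open>Closure properties of c.e. sets\<close>

lemma ce_UNIV: "ce UNIV"
proof -
  have "decidable 2 (\<lambda>e. e 0 = e 0)"
    by (intro computable_intros) simp_all
  from ce_decidable[of "\<lambda>s x. s = s", OF this] show ?thesis by simp
qed

lemma ce_Un:
  assumes "ce A" "ce B" shows "ce (A \<union> B)"
proof -
  obtain P Q where P: "decidable 2 (\<lambda>e. P (e 0) (e 1))" "A = {x. \<exists>s. P s x}"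
    and Q: "decidable 2 (\<lambda>e. Q (e 0) (e 1))" "B = {x. \<exists>s. Q s x}"
    using assms by (auto simp: ce_iff_decidable)
  have "ce {x. \<exists>s. P s x \<or> Q s x}"
    by (intro ce_decidable computable_intros P Q)
  then show ?thesis by (simp add: P Q Collect_disj_eq ex_disj_distrib)
qed

lemma ce_vimage:
  assumes "ce A" "computable 1 (\<lambda>e. f (e 0))" shows "ce {x. f x \<in> A}"
proof -
  obtain P where P: "decidable 2 (\<lambda>e. P (e 0) (e 1))" "A = {x. \<exists>s. P s x}"
    using assms by (auto simp: ce_iff_decidable)
  have "decidable 2 (\<lambda>e. P (e 0) (f (e 1)))"
    by (intro decidable_subst2[OF P(1)] computable_compose1[OF assms(2)] computable_var) simp_all
  from ce_decidable[OF this] show ?thesis by (simp add: P)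
qed

lemma ce_join:
  assumes "ce A" "ce B" shows "ce (join A B)"
proof -
  obtain P Q where P: "decidable 2 (\<lambda>e. P (e 0) (e 1))" "A = {x. \<exists>s. P s x}"
    and Q: "decidable 2 (\<lambda>e. Q (e 0) (e 1))" "B = {x. \<exists>s. Q s x}"
    using assms by (auto simp: ce_iff_decidable)
  \<comment> \<open>Half of \<open>x\<close> is found by a search below \<open>Suc x\<close>, which
    avoids division.\<close>
  have "ce {x. \<exists>s. \<exists>y<Suc x. x = 2 * y \<and> P s y \<or> x = Suc (2 * y) \<and> Q s y}"
    by (intro ce_decidable computable_intros decidable_subst2[OF P(1)] decidable_subst2[OF Q(1)]) simp_all
  also have "{x. \<exists>s. \<exists>y<Suc x. x = 2 * y \<and> P s y \<or> x = Suc (2 * y) \<and> Q s y} = join A B"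
    by (rule sym) (auto simp: join_eq_iff P Q double_not_eq_Suc_double Suc_double_not_eq_double)
  finally show ?thesis .
qed

text \<open>Representatives are chosen so that this is a function of classes; the class of the join
  does not depend on the choice. On \<open>carrier E_star\<close> it is an order isomorphism from
  the square, as the lemmas on it show.\<close>

definition class_join :: "nat set set \<Rightarrow> nat set set \<Rightarrow> nat set set" where
  "class_join U V = fin_class (join (SOME A. A \<in> U) (SOME B. B \<in> V))"

lemma some_fin_class:
  assumes "ce A"
  shows "ce (SOME A'. A' \<in> fin_class A)" "fin_class (SOME A'. A' \<in> fin_class A) = fin_class A"
proof -
  define A' where "A' = (SOME A'. A' \<in> fin_class A)"
  have "A \<in> fin_class A" using assms by (simp add: fin_class_def eq_fin_def)
  then have "A' \<in> fin_class A" unfolding A'_def by (rule someI)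
  then have A': "ce A'" "finite (A - A')" "finite (A' - A)" by (simp_all add: fin_class_def eq_fin_def)
  then have "fin_class A' = fin_class A" using assms by (simp add: fin_class_eq_iff)
  with A'(1) show "ce (SOME A'. A' \<in> fin_class A)" "fin_class (SOME A'. A' \<in> fin_class A) = fin_class A"
    by (simp_all only: A'_def)
qed

lemma fin_class_join_eq_iff:
  assumes "ce A" "ce B" "ce A'" "ce B'"
  shows "fin_class (join A B) = fin_class (join A' B') \<longleftrightarrow>
    fin_class A = fin_class A' \<and> fin_class B = fin_class B'"
  using assms by (auto simp: fin_class_eq_iff ce_join join_Diff finite_join_iff)

lemma class_join_fin_class:
  assumes "ce A" "ce B"
  shows "class_join (fin_class A) (fin_class B) = fin_class (join A B)"
  unfolding class_join_def using assms by (simp add: fin_class_join_eq_iff some_fin_class)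

lemma class_join_in_carrier:
  assumes "U \<in> carrier E_star" "V \<in> carrier E_star"
  shows "class_join U V \<in> carrier E_star"
  using assms by (auto simp: carrier_E_star class_join_fin_class ce_join)

lemma class_join_eq_iff:
  assumes "U \<in> carrier E_star" "V \<in> carrier E_star" "U' \<in> carrier E_star" "V' \<in> carrier E_star"
  shows "class_join U V = class_join U' V' \<longleftrightarrow> U = U' \<and> V = V'"
  using assms by (auto simp: carrier_E_star class_join_fin_class fin_class_join_eq_iff)

lemma class_join_le_iff:
  assumes "U \<in> carrier E_star" "V \<in> carrier E_star" "U' \<in> carrier E_star" "V' \<in> carrier E_star"
  shows "le_fin (class_join U V) (class_join U' V') \<longleftrightarrow> le_fin U U' \<and> le_fin V V'"
  using assms
  by (auto simp: carrier_E_star class_join_fin_class le_fin_fin_class ce_join join_Diff finite_join_iff)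

text \<open>Surjectivity of the pairing: both halves of a c.e. set are preimages under computable
  maps.\<close>

lemma ex_class_join:
  assumes "W \<in> carrier E_star"
  shows "\<exists>U\<in>carrier E_star. \<exists>V\<in>carrier E_star. W = class_join U V"
proof -
  obtain A where A: "ce A" "W = fin_class A" using assms by (auto simp: carrier_E_star)
  have *: "ce {x. 2 * x \<in> A}" "ce {x. Suc (2 * x) \<in> A}"
    by (rule ce_vimage[OF A(1)], intro computable_intros, simp)+
  then have "W = class_join (fin_class {x. 2 * x \<in> A}) (fin_class {x. Suc (2 * x) \<in> A})"
    using A join_split[of A] by (simp add: class_join_fin_class)
  with * show ?thesis by (auto simp: carrier_E_star)
qed

lemma ex_carrier_class_join:
  "(\<exists>W\<in>carrier E_star. P W) \<longleftrightarrow> (\<exists>U\<in>carrier E_star. \<exists>V\<in>carrier E_star. P (class_join U V))"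
  using ex_class_join class_join_in_carrier by metis


section \<open>Definable relations of the two halves\<close>

text \<open>Full assignments, rather than values at the free variables, let the induction on
  formulas pass through quantifiers by plain updates.\<close>

definition sections :: "fm \<Rightarrow> (nat \<Rightarrow> nat set set) \<Rightarrow> (nat \<Rightarrow> nat set set) set" where
  "sections \<phi> s = {t. range t \<subseteq> carrier E_star \<and> sat E_star (\<lambda>i. class_join (s i) (t i)) \<phi>}"

text \<open>A Feferman-Vaught argument: only finitely many sections arise from a fixed formula, since
  a quantifier over pairs sees the first component only through the section it determines.\<close>

lemma finite_sections: "finite (sections \<phi> ` {s. range s \<subseteq> carrier E_star})"
proof (induction \<phi>)
  case (FEq i j)
  \<comment> \<open>The first coordinates only decide whether the atomic formula can still hold,
    which leaves two possible sections.\<close>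
  have "sections (FEq i j) s \<in> {{}, {t. range t \<subseteq> carrier E_star \<and> t i = t j}}"
    if "range s \<subseteq> carrier E_star" for s
  proof -
    have "sat E_star (\<lambda>i. class_join (s i) (t i)) (FEq i j) \<longleftrightarrow> s i = s j \<and> t i = t j"
      if "range t \<subseteq> carrier E_star" for t
      using that \<open>range s \<subseteq> carrier E_star\<close> by (simp add: class_join_eq_iff image_subset_iff)
    then show ?thesis by (auto simp: sections_def)
  qed
  then have "sections (FEq i j) ` {s. range s \<subseteq> carrier E_star} \<subseteq>
      {{}, {t. range t \<subseteq> carrier E_star \<and> t i = t j}}"
    by blast
  then show ?case by (rule finite_subset) simp
next
  case (FLe i j)
  have "sections (FLe i j) s \<in> {{}, {t. range t \<subseteq> carrier E_star \<and> le_fin (t i) (t j)}}"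
    if "range s \<subseteq> carrier E_star" for s
  proof -
    have "sat E_star (\<lambda>i. class_join (s i) (t i)) (FLe i j) \<longleftrightarrow> le_fin (s i) (s j) \<and> le_fin (t i) (t j)"
      if "range t \<subseteq> carrier E_star" for t
      using that \<open>range s \<subseteq> carrier E_star\<close>
      by (simp add: class_join_le_iff image_subset_iff E_star_def[THEN arg_cong[of _ _ le]])
    then show ?thesis by (auto simp: sections_def)
  qed
  then have "sections (FLe i j) ` {s. range s \<subseteq> carrier E_star} \<subseteq>
      {{}, {t. range t \<subseteq> carrier E_star \<and> le_fin (t i) (t j)}}"
    by blast
  then show ?case by (rule finite_subset) simp
next
  case (FNeg \<phi>)
  have "sections (FNeg \<phi>) s = {t. range t \<subseteq> carrier E_star} - sections \<phi> s" for s
    by (auto simp: sections_def)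
  then have "sections (FNeg \<phi>) ` S = (\<lambda>Y. {t. range t \<subseteq> carrier E_star} - Y) ` sections \<phi> ` S" for S
    by (simp add: image_image)
  then show ?case using FNeg by simp
next
  case (FConj \<phi> \<psi>)
  have "sections (FConj \<phi> \<psi>) s = sections \<phi> s \<inter> sections \<psi> s" for s
    by (auto simp: sections_def)
  then have "sections (FConj \<phi> \<psi>) ` S \<subseteq> (\<lambda>(Y, Z). Y \<inter> Z) ` (sections \<phi> ` S \<times> sections \<psi> ` S)" for S
    by auto
  then show ?case by (rule finite_subset) (use FConj in simp)
next
  case (FEx i \<phi>)
  define S :: "(nat \<Rightarrow> nat set set) set" where "S = {s. range s \<subseteq> carrier E_star}"
  \<comment> \<open>\<open>G\<close> recovers the section of the quantified formula from the family
    of sections of \<open>\<phi>\<close> obtained by varying \<open>s\<close> at \<open>i\<close>.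
    This family is a subset of a finite set, so only finitely many results occur.\<close>
  define G where "G \<Y> = {t \<in> S. \<exists>Y\<in>\<Y>. \<exists>b\<in>carrier E_star. t(i := b) \<in> Y}"
    for \<Y>
  have "sections (FEx i \<phi>) s = G ((\<lambda>a. sections \<phi> (s(i := a))) ` carrier E_star)" for s
  proof -
    have upd: "(\<lambda>j. class_join (s j) (t j))(i := class_join a b) =
        (\<lambda>j. class_join ((s(i := a)) j) ((t(i := b)) j))" for t a b
      by (rule ext) simp
    have "range (t(i := b)) \<subseteq> carrier E_star" if "range t \<subseteq> carrier E_star" "b \<in> carrier E_star" for t b
      using that by auto
    then show ?thesis
      unfolding sections_def G_def S_def sat.simps
      by (subst ex_carrier_class_join) (auto simp only: upd mem_Collect_eq bex_simps; blast)
  qed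
  moreover have "(\<lambda>a. sections \<phi> (s(i := a))) ` carrier E_star \<subseteq> sections \<phi> ` S" if "s \<in> S" for s
    using that by (auto simp: S_def intro!: imageI)
  ultimately have "sections (FEx i \<phi>) ` S \<subseteq> G ` Pow (sections \<phi> ` S)"
    by auto
  then show ?case
    unfolding S_def[symmetric] by (rule finite_subset) (use FEx in \<open>simp add: S_def\<close>)
qed


section \<open>Counting atoms\<close>

text \<open>Atoms above a class are described inside \<open>E_star\<close>, where the pairing can be
  applied to them.\<close>

definition covers :: "nat set set \<Rightarrow> nat set set set" where
  "covers a = {u \<in> carrier E_star. le_fin a u \<and> u \<noteq> a \<and>
    (\<forall>v\<in>carrier E_star. le_fin a v \<and> le_fin v u \<longrightarrow> v = a \<or> v = u)}"

lemma le_fin_refl: "a \<in> carrier E_star \<Longrightarrow> le_fin a a"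
  by (auto simp: carrier_E_star le_fin_fin_class)

lemma le_fin_antisym:
  assumes "a \<in> carrier E_star" "b \<in> carrier E_star" "le_fin a b" "le_fin b a"
  shows "a = b"
proof -
  obtain A B where "ce A" "ce B" "a = fin_class A" "b = fin_class B"
    using assms(1,2) by (auto simp: carrier_E_star)
  then show ?thesis using assms(3,4) by (simp add: le_fin_fin_class fin_class_eq_iff)
qed

text \<open>A class above that of \<open>A\<close> contains a genuine superset of \<open>A\<close>:
  add to a representative the finitely many missing elements by taking its union with
  \<open>A\<close>.\<close>

lemma carrier_L_star_le:
  assumes "ce A" shows "carrier (L_star A) = {u \<in> carrier E_star. le_fin (fin_class A) u}"
proof (intro equalityI subsetI)
  fix u assume "u \<in> carrier (L_star A)"
  then obtain W where W: "ce W" "A \<subseteq> W" "u = fin_class W" by (auto simp: carrier_L_star)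
  then have "finite (A - W)" by (simp add: Diff_eq_empty_iff[THEN iffD2])
  with W show "u \<in> {u \<in> carrier E_star. le_fin (fin_class A) u}"
    by (simp add: carrier_E_star le_fin_fin_class assms)
next
  fix u assume "u \<in> {u \<in> carrier E_star. le_fin (fin_class A) u}"
  then obtain W where W: "ce W" "u = fin_class W" "finite (A - W)"
    using assms by (auto simp: carrier_E_star le_fin_fin_class)
  have "finite (W - (W \<union> A))" by (rule finite_subset[of _ "{}"]) auto
  then have "u = fin_class (W \<union> A)"
    using W assms by (simp add: fin_class_eq_iff ce_Un Un_Diff)
  then show "u \<in> carrier (L_star A)" using W assms ce_Un by (auto simp: carrier_L_star)
qed

lemma atoms_L_star:
  assumes "ce A" shows "atoms (L_star A) = covers (fin_class A)"
proof -
  have le: "le (L_star A) = le_fin" and car: "carrier (L_star A) = {u \<in> carrier E_star. le_fin (fin_class A) u}"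
    using carrier_L_star_le[OF assms] by (simp_all add: L_star_def)
  have A: "fin_class A \<in> carrier E_star" using assms by (auto simp: carrier_E_star)
  have "least (L_star A) x (carrier (L_star A)) \<longleftrightarrow> x = fin_class A" for x
    unfolding least_def le car using A le_fin_refl le_fin_antisym by blast
  then have "\<bottom>\<^bsub>L_star A\<^esub> = fin_class A" by (simp add: bottom_def)
  then show ?thesis unfolding atoms_def covers_def le car by auto
qed

text \<open>In a product of orders a cover changes exactly one coordinate, and there by a cover: if
  both changed, changing only one would give something strictly between.\<close>

lemma covers_class_join:
  assumes a: "a \<in> carrier E_star" and b: "b \<in> carrier E_star"
  shows "covers (class_join a b) = (\<lambda>u. class_join u b) ` covers a \<union> class_join a ` covers b"
proof (intro equalityI subsetI)
  fix w assume w: "w \<in> covers (class_join a b)"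
  then obtain u v where u: "u \<in> carrier E_star" and v: "v \<in> carrier E_star" and w_eq: "w = class_join u v"
    using ex_class_join[of w] by (auto simp: covers_def)
  have le: "le_fin a u" "le_fin b v" and neq: "u \<noteq> a \<or> v \<noteq> b"
    using w a b u v by (auto simp: covers_def w_eq class_join_le_iff)
  have min: "u' = a \<and> v' = b \<or> u' = u \<and> v' = v"
    if "u' \<in> carrier E_star" "v' \<in> carrier E_star" "le_fin a u'" "le_fin u' u" "le_fin b v'" "le_fin v' v" for u' v'
  proof -
    have "\<forall>x\<in>carrier E_star. le_fin (class_join a b) x \<and> le_fin x w \<longrightarrow> x = class_join a b \<or> x = w"
      using w by (simp add: covers_def)
    from bspec[OF this class_join_in_carrier[OF that(1,2)]] show ?thesis
      using that a b u v by (simp add: w_eq class_join_le_iff class_join_eq_iff)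
  qed
  \<comment> \<open>The pair \<open>(a, v)\<close> lies between \<open>(a, b)\<close> and
    \<open>(u, v)\<close>, so it equals one of them.\<close>
  have "u = a \<or> v = b" using min[of a v] a v le le_fin_refl by blast
  then show "w \<in> (\<lambda>u. class_join u b) ` covers a \<union> class_join a ` covers b"
  proof
    assume "u = a"
    then have "v \<in> covers b" using min[of a] neq v a le le_fin_refl by (auto simp: covers_def)
    then show ?thesis by (simp add: w_eq \<open>u = a\<close>)
  next
    assume "v = b"
    then have "u \<in> covers a" using min[of _ b] neq u b le le_fin_refl by (auto simp: covers_def)
    then show ?thesis by (simp add: w_eq \<open>v = b\<close>)
  qed
next
  fix w assume "w \<in> (\<lambda>u. class_join u b) ` covers a \<union> class_join a ` covers b"
  then obtain u v where u: "u \<in> carrier E_star" and v: "v \<in> carrier E_star" and w_eq: "w = class_join u v"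
    and uv: "u \<in> covers a \<and> v = b \<or> u = a \<and> v \<in> covers b"
    using a b by (auto simp: covers_def)
  have le: "le_fin a u" "le_fin b v" using uv a b le_fin_refl by (auto simp: covers_def)
  have "class_join u v \<noteq> class_join a b"
    using uv u v a b by (auto simp: covers_def class_join_eq_iff)
  moreover have "w' = class_join a b \<or> w' = class_join u v"
    if "w' \<in> carrier E_star" "le_fin (class_join a b) w'" "le_fin w' (class_join u v)" for w'
  proof -
    obtain u' v' where w': "u' \<in> carrier E_star" "v' \<in> carrier E_star" "w' = class_join u' v'"
      using ex_class_join[of w'] \<open>w' \<in> carrier E_star\<close> by blast
    then have "le_fin a u'" "le_fin b v'" "le_fin u' u" "le_fin v' v"
      using that(2,3) a b u v by (simp_all add: class_join_le_iff)
    then have "u' = a \<and> v' = b \<or> u' = u \<and> v' = v"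
      using uv w'(1,2) a b le_fin_antisym unfolding covers_def by blast
    then show ?thesis by (auto simp: w'(3))
  qed
  ultimately show "w \<in> covers (class_join a b)"
    using a b u v le by (simp add: covers_def w_eq class_join_le_iff class_join_in_carrier)
qed

text \<open>Finiteness is recorded because \<open>card\<close> is 0 on infinite sets, which would
  spoil additivity.\<close>

definition atom_count :: "nat set \<Rightarrow> nat \<Rightarrow> bool" where
  "atom_count A n \<longleftrightarrow> finite (atoms (L_star A)) \<and> n_atoms A = n"

lemma atom_count_join:
  assumes "ce A" "ce B" "atom_count A m" "atom_count B n"
  shows "atom_count (join A B) (m + n)"
proof -
  define a where "a = fin_class A"
  define b where "b = fin_class B"
  have ab: "a \<in> carrier E_star" "b \<in> carrier E_star"
    using assms by (auto simp: a_def b_def carrier_E_star)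
  have sub: "covers a \<subseteq> carrier E_star" "covers b \<subseteq> carrier E_star" and notin: "a \<notin> covers a" "b \<notin> covers b"
    by (auto simp: covers_def)
  have inj: "inj_on (\<lambda>u. class_join u b) (covers a)" "inj_on (class_join a) (covers b)"
    using ab sub by (auto simp: inj_on_def class_join_eq_iff subset_iff)
  have disj: "(\<lambda>u. class_join u b) ` covers a \<inter> class_join a ` covers b = {}"
    using ab sub notin by (auto simp: class_join_eq_iff subset_iff)
  have "finite (covers a)" "finite (covers b)" "card (covers a) = m" "card (covers b) = n"
    using assms by (simp_all add: atom_count_def n_atoms_def atoms_L_star a_def b_def)
  moreover have "atoms (L_star (join A B)) = (\<lambda>u. class_join u b) ` covers a \<union> class_join a ` covers b"
    using covers_class_join[OF ab] assms(1,2)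
    by (simp add: atoms_L_star ce_join a_def b_def class_join_fin_class)
  ultimately show ?thesis
    using inj disj by (simp add: atom_count_def n_atoms_def card_Un_disjoint card_image)
qed

text \<open>The number of atoms depends only on the class, so membership in the class to be defined
  may be tested on any quasimaximal representative.\<close>

lemma n_atoms_cong:
  assumes "ce A" "ce B" "fin_class A = fin_class B"
  shows "n_atoms A = n_atoms B"
  using assms by (simp add: n_atoms_def atoms_L_star)

lemma atom_count_UNIV: "atom_count UNIV 0"
proof -
  have "u = fin_class UNIV" if "u \<in> carrier E_star" "le_fin (fin_class UNIV) u" for u
  proof -
    obtain W where "ce W" "u = fin_class W" using \<open>u \<in> carrier E_star\<close> by (auto simp: carrier_E_star)
    then show ?thesis using that(2) by (simp add: le_fin_fin_class ce_UNIV fin_class_eq_iff)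
  qed
  then have "covers (fin_class UNIV) = {}" by (auto simp: covers_def)
  then show ?thesis by (simp add: atom_count_def n_atoms_def atoms_L_star ce_UNIV)
qed

text \<open>Above a maximal set there is, modulo finite differences, only the class of
  \<open>UNIV\<close>.\<close>

lemma atom_count_maximal:
  assumes "maximal_ce M" shows "atom_count M 1"
proof -
  have "ce M" "infinite (- M)" using assms by (auto simp: maximal_ce_def)
  have max: "finite (W - M) \<or> finite (- W)" if "ce W" "M \<subseteq> W" for W
    using assms that by (auto simp: maximal_ce_def)
  \<comment> \<open>In \<open>E_star\<close> supersets are such only up to finite sets; passing to
    the union with \<open>M\<close> transfers maximality to them.\<close>
  have max': "finite (W - M) \<or> finite (- W)" if "ce W" "finite (M - W)" for W
  proof -
    have "finite (W \<union> M - M) \<or> finite (- (W \<union> M))"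
      using max[of "W \<union> M"] that(1) \<open>ce M\<close> ce_Un by blast
    moreover have "- W \<subseteq> - (W \<union> M) \<union> (M - W)" by auto
    ultimately show ?thesis using that(2) by (auto simp: Un_Diff intro: finite_subset)
  qed
  have "covers (fin_class M) = {fin_class UNIV}"
  proof (intro equalityI subsetI)
    fix u assume u: "u \<in> covers (fin_class M)"
    then obtain W where W: "ce W" "u = fin_class W" by (auto simp: covers_def carrier_E_star)
    with u \<open>ce M\<close> have "finite (M - W)" "infinite (W - M)"
      by (auto simp: covers_def le_fin_fin_class fin_class_eq_iff)
    with max' W(1) have "finite (- W)" by blast
    then show "u \<in> {fin_class UNIV}"
      using W by (simp add: fin_class_eq_iff ce_UNIV Compl_eq_Diff_UNIV)
  next
    fix u assume "u \<in> {fin_class UNIV}"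
    then show "u \<in> covers (fin_class M)"
      using \<open>ce M\<close> \<open>infinite (- M)\<close> max'
      by (auto simp: covers_def carrier_E_star le_fin_fin_class ce_UNIV fin_class_eq_iff Compl_eq_Diff_UNIV)
  qed
  then show ?thesis using \<open>ce M\<close> by (simp add: atom_count_def n_atoms_def atoms_L_star)
qed


section \<open>Quasimaximal sets with a given number of atoms\<close>

text \<open>A superset contains one half entirely, so it is determined by its other half, where
  maximality of \<open>M\<close> applies.\<close>

lemma maximal_ce_join_UNIV:
  assumes "maximal_ce M"
  shows "maximal_ce (join M UNIV)" "maximal_ce (join UNIV M)"
proof -
  have "ce M" "infinite (- M)" using assms by (auto simp: maximal_ce_def)
  then have "ce (join M UNIV)" "infinite (- join M UNIV)" "ce (join UNIV M)" "infinite (- join UNIV M)"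
    by (simp_all add: ce_join ce_UNIV Compl_join finite_join_iff)
  moreover have "finite (W - join M UNIV) \<or> finite (- W)" if "ce W" "join M UNIV \<subseteq> W" for W
  proof -
    have W: "W = join {x. 2 * x \<in> W} UNIV"
      using that(2) by (intro sym[of "join _ _"]) (auto simp: join_eq_iff join_subset_iff)
    have "ce {x. 2 * x \<in> W}"
      by (rule ce_vimage[OF that(1)], intro computable_intros, simp)
    then have "finite ({x. 2 * x \<in> W} - M) \<or> finite (- {x. 2 * x \<in> W})"
      using assms that(2) by (auto simp: maximal_ce_def join_subset_iff)
    then show ?thesis
      by (subst (1 2) W) (simp add: join_Diff Compl_join finite_join_iff)
  qed
  moreover have "finite (W - join UNIV M) \<or> finite (- W)" if "ce W" "join UNIV M \<subseteq> W" for W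
  proof -
    have W: "W = join UNIV {x. Suc (2 * x) \<in> W}"
      using that(2) by (intro sym[of "join _ _"]) (auto simp: join_eq_iff join_subset_iff)
    have "ce {x. Suc (2 * x) \<in> W}"
      by (rule ce_vimage[OF that(1)], intro computable_intros, simp)
    then have "finite ({x. Suc (2 * x) \<in> W} - M) \<or> finite (- {x. Suc (2 * x) \<in> W})"
      using assms that(2) by (auto simp: maximal_ce_def join_subset_iff)
    then show ?thesis
      by (subst (1 2) W) (simp add: join_Diff Compl_join finite_join_iff)
  qed
  ultimately show "maximal_ce (join M UNIV)" "maximal_ce (join UNIV M)"
    unfolding maximal_ce_def by blast+
qed

lemma quasimaximal_UNIV: "quasimaximal UNIV"
  unfolding quasimaximal_def by (intro conjI ce_UNIV exI[of _ "{}"]) auto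

lemma quasimaximal_maximal: "maximal_ce M \<Longrightarrow> quasimaximal M"
  unfolding quasimaximal_def by (intro conjI exI[of _ "{M}"]) (auto simp: maximal_ce_def)

text \<open>Each maximal set of either family is padded by \<open>UNIV\<close> in the other half.
  The padded sets are maximal, and their intersection is the join, also when a family is
  empty.\<close>

lemma quasimaximal_join:
  assumes "quasimaximal A" "quasimaximal B"
  shows "quasimaximal (join A B)"
proof -
  obtain \<M> \<N> where M: "finite \<M>" "\<forall>M\<in>\<M>. maximal_ce M" "A = \<Inter>\<M>"
    and N: "finite \<N>" "\<forall>N\<in>\<N>. maximal_ce N" "B = \<Inter>\<N>" and ce: "ce A" "ce B"
    using assms by (auto simp: quasimaximal_def)
  have "\<forall>x. x \<in> join A B \<longleftrightarrow> (\<forall>M\<in>\<M>. x \<in> join M UNIV) \<and> (\<forall>N\<in>\<N>. x \<in> join UNIV N)"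
    by (subst all_double) (simp add: M(3) N(3))
  then have "join A B = \<Inter>((\<lambda>M. join M UNIV) ` \<M> \<union> join UNIV ` \<N>)"
    by (simp only: set_eq_iff Inter_iff ball_Un ball_simps simp_thms)
  then show ?thesis
    unfolding quasimaximal_def using M(1,2) N(1,2) ce
    by (intro conjI ce_join exI[of _ "(\<lambda>M. join M UNIV) ` \<M> \<union> join UNIV ` \<N>"])
      (auto simp: maximal_ce_join_UNIV)
qed

primrec max_copies :: "nat \<Rightarrow> nat set" where
  "max_copies 0 = UNIV"
| "max_copies (Suc k) = join max_set (max_copies k)"

lemma max_copies: "quasimaximal (max_copies k) \<and> atom_count (max_copies k) k"
proof (induction k)
  case (Suc k)
  then have "ce (max_copies k)" by (simp add: quasimaximal_def)
  then have "atom_count (join max_set (max_copies k)) (1 + k)"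
    using Suc by (intro atom_count_join ce_max_set atom_count_maximal maximal_ce_max_set) simp_all
  then show ?case
    using Suc by (simp add: quasimaximal_join quasimaximal_maximal maximal_ce_max_set)
qed (simp add: quasimaximal_UNIV atom_count_UNIV)

section \<open>The pigeonhole argument\<close>

theorem theorem4p28:
  fixes X :: "nat set"
  assumes "infinite X"
    and "\<forall>n\<in>X. even n"
    and "\<forall>n\<in>X. \<forall>m\<in>X. n \<noteq> m \<longrightarrow> (n + m) div 2 \<notin> X"
  shows "\<not> FO_definable E_star {fin_class A | A. quasimaximal A \<and> n_atoms A \<in> X}"
proof
  let ?C = "{fin_class A | A. quasimaximal A \<and> n_atoms A \<in> X}"
  assume "FO_definable E_star ?C"
  then obtain \<phi> where \<phi>: "?C = {a \<in> carrier E_star. sat E_star (\<lambda>_. a) \<phi>}"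
    by (auto simp: FO_definable_def)
  define a where "a n = fin_class (max_copies (n div 2))" for n
  have copies: "quasimaximal (max_copies k)" "ce (max_copies k)" "atom_count (max_copies k) k" for k
    using max_copies[of k] by (auto simp: quasimaximal_def)
  have a: "a n \<in> carrier E_star" for n
    using copies by (auto simp: a_def carrier_E_star)
  have join_in: "class_join (a m) (a n) \<in> ?C \<longleftrightarrow> (m + n) div 2 \<in> X" if "m \<in> X" "n \<in> X" for m n
  proof -
    define J where "J = join (max_copies (m div 2)) (max_copies (n div 2))"
    \<comment> \<open>Evenness enters here: the halves add up without rounding.\<close>
    have "m div 2 + n div 2 = (m + n) div 2" using assms(2) that by auto
    then have J: "quasimaximal J" "n_atoms J = (m + n) div 2"
      using quasimaximal_join copies atom_count_join unfolding J_def atom_count_def by metis+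
    have "class_join (a m) (a n) = fin_class J"
      by (simp add: a_def J_def class_join_fin_class copies)
    moreover have "fin_class J \<in> ?C \<longleftrightarrow> n_atoms J \<in> X"
    proof
      assume "fin_class J \<in> ?C"
      then obtain A where "fin_class J = fin_class A" "quasimaximal A" "n_atoms A \<in> X" by blast
      then show "n_atoms J \<in> X" using J(1) n_atoms_cong[of J A] by (simp add: quasimaximal_def)
    qed (use J(1) in blast)
    ultimately show ?thesis using J(2) by simp
  qed
  \<comment> \<open>Constant assignments in the two halves combine to the constant assignment at
    which \<open>FO_definable\<close> evaluates the formula.\<close>
  have mem: "(\<lambda>_. a n) \<in> sections \<phi> (\<lambda>_. a m) \<longleftrightarrow> (m + n) div 2 \<in> X" if "m \<in> X" "n \<in> X" for m n
  proof -
    have "class_join (a m) (a n) \<in> ?C \<longleftrightarrow> sat E_star (\<lambda>_. class_join (a m) (a n)) \<phi>"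
      unfolding \<phi> using class_join_in_carrier[OF a a, of m n] by blast
    moreover have "(\<lambda>_. a n) \<in> sections \<phi> (\<lambda>_. a m) \<longleftrightarrow> sat E_star (\<lambda>_. class_join (a m) (a n)) \<phi>"
      using a by (auto simp only: sections_def mem_Collect_eq)
    ultimately show ?thesis using join_in[OF that] by blast
  qed
  have "(\<lambda>n. sections \<phi> (\<lambda>_. a n)) ` X \<subseteq> sections \<phi> ` {s. range s \<subseteq> carrier E_star}"
    using a by auto
  then have "finite ((\<lambda>n. sections \<phi> (\<lambda>_. a n)) ` X)"
    by (rule finite_subset[OF _ finite_sections])
  then have "\<not> inj_on (\<lambda>n. sections \<phi> (\<lambda>_. a n)) X"
    using assms(1) finite_imageD by blast
  then obtain n m where nm: "n \<in> X" "m \<in> X" "n \<noteq> m" "sections \<phi> (\<lambda>_. a n) = sections \<phi> (\<lambda>_. a m)"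
    by (auto simp: inj_on_def)
  have "(n + n) div 2 = n" by simp
  then have "(\<lambda>_. a n) \<in> sections \<phi> (\<lambda>_. a n)" using mem[OF nm(1,1)] nm(1) by (simp only:)
  then have "(m + n) div 2 \<in> X" unfolding nm(4) using mem[OF nm(2,1)] by blast
  then show False using assms(3) nm(1-3) by metis
qed

end
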